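(* For every real $\lambda>0$, the leaf $\Sigma_\lambda=\{a+\lambda\in\Sigma: a\in\mathsf{HS}^h\}$ is a geodesically convex closed submanifold of $\Sigma$.
   Context: Let $H$ be a complex, infinite dimensional, separable Hilbert space, $\mathsf{HS}$ the Hilbert-Schmidt operators on $H$, $\mathsf{HS}^h$ the self-adjoint ones, and $\mathcal H_{\mathbb R}=\{a+\lambda:a\in\mathsf{HS}^h,\lambda\in\mathbb R\}$, a real Hilbert space with $\langle a+\lambda,b+\beta\rangle_2=4\,\mathrm{tr}(ab^* )+\lambda\beta$. $\Sigma$ is the set of positive invertible operators in $\mathcal H_{\mathbb R}$, open in $\mathcal H_{\mathbb R}$, with $T_p\Sigma=\mathcal H_{\mathbb R}$ and Riemannian metric given by $\|x\|_p=\|p^{-1/2}xp^{-1/2}\|_2$. The unique geodesic joining $p,q\in\Sigma$ is $\gamma_{pq}(t)=p^{1/2}(p^{-1/2}qp^{-1/2})^tp^{1/2}$; $M\subset\Sigma$ is geodesically convex if $\gamma_{pq}([0,1])\subset M$ for all $p,q\in M$. *)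

theory Defs
  imports "HOL-Analysis.Analysis"
begin

section \<open>Complex Hilbert spaces\<close>

text \<open>A complex Hilbert space is presented through its underlying real Hilbert space, whose inner
  product is the real part of the complex one; hence the norm is the one induced by \<open>cinner\<close>.\<close>

class complex_hilbert = real_inner + complete_space +
  fixes scaleC :: "complex \<Rightarrow> 'a \<Rightarrow> 'a" (infixr "*\<^sub>C" 75)
    and cinner :: "'a \<Rightarrow> 'a \<Rightarrow> complex"
  assumes scaleC_add_right: "c *\<^sub>C (x + y) = c *\<^sub>C x + c *\<^sub>C y"
    and scaleC_add_left: "(c + d) *\<^sub>C x = c *\<^sub>C x + d *\<^sub>C x"
    and scaleC_scaleC: "c *\<^sub>C d *\<^sub>C x = (c * d) *\<^sub>C x"
    and scaleR_scaleC: "r *\<^sub>R x = complex_of_real r *\<^sub>C x"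
    and cinner_commute: "cinner x y = cnj (cinner y x)"
    and cinner_add_left: "cinner (x + y) z = cinner x z + cinner y z"
    and cinner_scaleC_left: "cinner (c *\<^sub>C x) y = c * cinner x y"
    and Re_cinner: "Re (cinner x y) = inner x y"

instance complex_hilbert \<subseteq> banach ..

class inf_sep_complex_hilbert = complex_hilbert +
  assumes infinite_dim: "finite S \<Longrightarrow> \<exists>x. \<forall>c. x \<noteq> (\<Sum>v\<in>S. c v *\<^sub>C v)"
    and separable: "\<exists>D. countable D \<and> (\<forall>x. \<forall>\<epsilon>>0. \<exists>d\<in>D. dist x d < \<epsilon>)"

definition is_onb :: "'h::complex_hilbert set \<Rightarrow> bool" where
  "is_onb B \<longleftrightarrow> (\<forall>e\<in>B. \<forall>f\<in>B. cinner e f = (if e = f then 1 else 0)) \<and>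
     (\<forall>x. (\<forall>e\<in>B. cinner x e = 0) \<longrightarrow> x = 0)"

text \<open>A fixed orthonormal basis. By lemma \<open>hs_basis_indep\<close> below, its choice is immaterial for the
  self-adjoint Hilbert-Schmidt operators and their Hilbert-Schmidt norm, hence by polarization also for
  the inner product \<open>Re (tr(ab\<^sup>*))\<close>, the only place where the trace is used.\<close>

definition some_onb :: "'h::complex_hilbert set" where
  "some_onb = (SOME B. is_onb B)"


section \<open>Operators\<close>

text \<open>Operators are elements of the (real) type of bounded linear maps that commute with complex
  scalars.\<close>

definition complex_linear :: "('h::complex_hilbert \<Rightarrow>\<^sub>L 'h) \<Rightarrow> bool" where
  "complex_linear T \<longleftrightarrow> (\<forall>c x. T (c *\<^sub>C x) = c *\<^sub>C T x)"

definition adj_op :: "('h::complex_hilbert \<Rightarrow>\<^sub>L 'h) \<Rightarrow> ('h \<Rightarrow>\<^sub>L 'h)" where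
  "adj_op T = (THE S :: 'h \<Rightarrow>\<^sub>L 'h. \<forall>x y. cinner (T x) y = cinner x (S y))"

definition selfadjoint :: "('h::complex_hilbert \<Rightarrow>\<^sub>L 'h) \<Rightarrow> bool" where
  "selfadjoint T \<longleftrightarrow> (\<forall>x y. cinner (T x) y = cinner x (T y))"

definition positive_op :: "('h::complex_hilbert \<Rightarrow>\<^sub>L 'h) \<Rightarrow> bool" where
  "positive_op T \<longleftrightarrow> complex_linear T \<and> (\<forall>x. cinner (T x) x \<in> \<real>\<^sub>\<ge>\<^sub>0)"

definition invertible_op :: "('h::complex_hilbert \<Rightarrow>\<^sub>L 'h) \<Rightarrow> bool" where
  "invertible_op T \<longleftrightarrow> (\<exists>S. S o\<^sub>L T = id_blinfun \<and> T o\<^sub>L S = id_blinfun)"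

definition HS :: "('h::complex_hilbert \<Rightarrow>\<^sub>L 'h) set" where
  "HS = {T. complex_linear T \<and> (\<lambda>e. (norm (T e))\<^sup>2) summable_on some_onb}"

definition HSh :: "('h::complex_hilbert \<Rightarrow>\<^sub>L 'h) set" where
  "HSh = {T \<in> HS. selfadjoint T}"

definition trace_op :: "('h::complex_hilbert \<Rightarrow>\<^sub>L 'h) \<Rightarrow> complex" where
  "trace_op T = (\<Sum>\<^sub>\<infinity>e\<in>some_onb. cinner (T e) e)"


subsection \<open>Continuous functional calculus for self-adjoint operators\<close>

definition cscale_op :: "complex \<Rightarrow> 'h::complex_hilbert \<Rightarrow>\<^sub>L 'h" where
  "cscale_op z = Blinfun (\<lambda>x. z *\<^sub>C x)"

definition op_spectrum :: "('h::complex_hilbert \<Rightarrow>\<^sub>L 'h) \<Rightarrow> complex set" where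
  "op_spectrum T = {z. \<not> invertible_op (T - cscale_op z)}"

definition poly_op :: "real poly \<Rightarrow> ('h::complex_hilbert \<Rightarrow>\<^sub>L 'h) \<Rightarrow> ('h \<Rightarrow>\<^sub>L 'h)" where
  "poly_op P T = (\<Sum>i\<le>degree P. coeff P i *\<^sub>R ((o\<^sub>L) T ^^ i) id_blinfun)"

text \<open>\<open>fun_calc f T\<close> is the limit of \<open>P\<^sub>n(T)\<close> for real polynomials \<open>P\<^sub>n\<close> converging to \<open>f\<close> uniformly
  on the spectrum. It is meant for self-adjoint \<open>T\<close>, whose spectrum is a compact set of reals, and
  for \<open>f\<close> continuous on the spectrum.\<close>

definition fun_calc :: "(real \<Rightarrow> real) \<Rightarrow> ('h::complex_hilbert \<Rightarrow>\<^sub>L 'h) \<Rightarrow> ('h \<Rightarrow>\<^sub>L 'h)" where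
  "fun_calc f T = (THE A. \<forall>P. uniform_limit {r. complex_of_real r \<in> op_spectrum T} (\<lambda>n. poly (P n)) f sequentially
      \<longrightarrow> (\<lambda>n. poly_op (P n) T) \<longlonglongrightarrow> A)"

definition op_powr :: "('h::complex_hilbert \<Rightarrow>\<^sub>L 'h) \<Rightarrow> real \<Rightarrow> ('h \<Rightarrow>\<^sub>L 'h)" where
  "op_powr T t = fun_calc (\<lambda>x. x powr t) T"


section \<open>Elementary facts\<close>

lemma cinner_self: "cinner x x = complex_of_real ((norm (x::'h::complex_hilbert))\<^sup>2)"
proof -
  have "Im (cinner x x) = 0"
    using cinner_commute[of x x] by (metis complex_cnj_cancel_iff Reals_cnj_iff complex_is_Real_iff)
  then show ?thesis
    by (simp add: complex_eq_iff Re_cinner power2_norm_eq_inner)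
qed

lemma cinner_add_right: "cinner x (y + z) = cinner x y + cinner (x::'h::complex_hilbert) z"
  by (metis cinner_add_left cinner_commute complex_cnj_add)

lemma cinner_scaleC_right: "cinner x (c *\<^sub>C y) = cnj c * cinner (x::'h::complex_hilbert) y"
  by (metis cinner_scaleC_left cinner_commute complex_cnj_mult)

lemma cinner_scaleR_left: "cinner (r *\<^sub>R x) y = complex_of_real r * cinner (x::'h::complex_hilbert) y"
  by (simp add: scaleR_scaleC cinner_scaleC_left)

lemma cinner_scaleR_right: "cinner x (r *\<^sub>R y) = complex_of_real r * cinner (x::'h::complex_hilbert) y"
  by (simp add: scaleR_scaleC cinner_scaleC_right)

lemma scaleC_diff_right: "c *\<^sub>C (x - y) = c *\<^sub>C x - c *\<^sub>C (y::'h::complex_hilbert)"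
  using scaleC_add_right[of c "x - y" y] by simp

lemma cinner_zero_left [simp]: "cinner 0 (x::'h::complex_hilbert) = 0"
  using cinner_add_left[of 0 0 x] by simp

lemma cinner_zero_right [simp]: "cinner (x::'h::complex_hilbert) 0 = 0"
  using cinner_add_right[of x 0 0] by simp

lemma cinner_minus_left: "cinner (- x) y = - cinner (x::'h::complex_hilbert) y"
  using cinner_add_left[of x "-x" y] by (simp add: eq_neg_iff_add_eq_0 add.commute)

lemma cinner_minus_right: "cinner x (- y) = - cinner (x::'h::complex_hilbert) y"
  using cinner_add_right[of x y "-y"] by (simp add: eq_neg_iff_add_eq_0 add.commute)

lemma cinner_diff_left: "cinner (x - y) z = cinner x z - cinner (y::'h::complex_hilbert) z"
  using cinner_add_left[of x "-y" z] by (simp add: cinner_minus_left)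

lemma cinner_diff_right: "cinner x (y - z) = cinner x y - cinner (x::'h::complex_hilbert) z"
  using cinner_add_right[of x y "-z"] by (simp add: cinner_minus_right)

lemma cinner_sum_left: "cinner (sum f A) y = (\<Sum>a\<in>A. cinner (f a) (y::'h::complex_hilbert))"
  by (induction A rule: infinite_finite_induct) (simp_all add: cinner_add_left)

lemma cinner_sum_right: "cinner y (sum f A) = (\<Sum>a\<in>A. cinner (y::'h::complex_hilbert) (f a))"
  by (induction A rule: infinite_finite_induct) (simp_all add: cinner_add_right)

lemma norm_scaleC: "norm (c *\<^sub>C x) = cmod c * norm (x::'h::complex_hilbert)"
proof -
  have "complex_of_real ((norm (c *\<^sub>C x))\<^sup>2) = complex_of_real ((cmod c * norm x)\<^sup>2)"
    by (simp only: cinner_self[symmetric] cinner_scaleC_left cinner_scaleC_right)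
      (simp add: cinner_self power_mult_distrib mult.assoc[symmetric] complex_norm_square del: of_real_power)
  then have "(norm (c *\<^sub>C x))\<^sup>2 = (cmod c * norm x)\<^sup>2"
    using of_real_eq_iff by blast
  then show ?thesis
    by (simp add: power2_eq_iff_nonneg)
qed

lemma cmod_cinner_le: "cmod (cinner x y) \<le> norm x * norm (y::'h::complex_hilbert)"
proof (cases "cinner x y = 0")
  case False
  let ?c = "cinner x y"
  have "(cmod ?c)\<^sup>2 = Re (cinner x (?c *\<^sub>C y))"
    unfolding cinner_scaleC_right cmod_power2 by (simp add: power2_eq_square)
  also have "\<dots> \<le> norm x * norm (?c *\<^sub>C y)"
    using norm_cauchy_schwarz[of x "?c *\<^sub>C y"] by (simp add: Re_cinner)
  also have "\<dots> = cmod ?c * (norm x * norm y)"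
    by (simp add: norm_scaleC)
  finally show ?thesis
    using False by (simp add: power2_eq_square)
qed simp

lemma bounded_linear_cinner_left: "bounded_linear (\<lambda>x. cinner x (y::'h::complex_hilbert))"
  by (rule bounded_linear_intro[where K="norm y"])
    (simp_all add: cinner_add_left cinner_scaleR_left cmod_cinner_le scaleR_conv_of_real)

lemma bounded_linear_cinner_right: "bounded_linear (\<lambda>x. cinner (y::'h::complex_hilbert) x)"
proof (rule bounded_linear_intro[where K="norm y"])
  show "norm (cinner y x) \<le> norm x * norm y" for x
    using cmod_cinner_le[of y x] by (simp add: mult.commute)
qed (simp_all add: cinner_add_right cinner_scaleR_right scaleR_conv_of_real)

lemma bounded_linear_scaleC: "bounded_linear (\<lambda>x::'h::complex_hilbert. c *\<^sub>C x)"
  by (rule bounded_linear_intro[where K="cmod c"])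
    (simp_all add: scaleC_add_right scaleR_scaleC scaleC_scaleC norm_scaleC mult.commute)

lemma cscale_op_apply: "cscale_op z x = z *\<^sub>C x"
  by (simp add: cscale_op_def bounded_linear_Blinfun_apply bounded_linear_scaleC)

lemma onb_exists: "\<exists>B. is_onb (B::'h::complex_hilbert set)"
proof -
  define A where "A = {B::'h set. \<forall>e\<in>B. \<forall>f\<in>B. cinner e f = (if e = f then 1 else 0)}"
  have un: "\<Union>C \<in> A" if "subset.chain A C" for C
  proof -
    have CA: "C \<subseteq> A" and ch: "\<And>X Y. X \<in> C \<Longrightarrow> Y \<in> C \<Longrightarrow> X \<subseteq> Y \<or> Y \<subseteq> X"
      using that by (auto simp: subset_chain_def)
    have "cinner e f = (if e = f then 1 else 0)" if XY: "e \<in> X" "X \<in> C" "f \<in> Y" "Y \<in> C" for e f X Y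
    proof -
      obtain Z where "Z \<in> C" "e \<in> Z" "f \<in> Z" using ch[OF XY(2,4)] XY by blast
      then show ?thesis using CA by (auto simp: A_def)
    qed
    then show ?thesis by (auto simp: A_def)
  qed
  have "\<exists>M\<in>A. \<forall>X\<in>A. M \<subseteq> X \<longrightarrow> X = M"
    using un by (rule subset_Zorn')
  then obtain M where M: "M \<in> A" "\<And>X. X \<in> A \<Longrightarrow> M \<subseteq> X \<Longrightarrow> X = M"
    by blast
  have tot: "x = 0" if x: "\<forall>e\<in>M. cinner x e = 0" for x
  proof (rule ccontr)
    assume "x \<noteq> 0"
    define u where "u = (1 / norm x) *\<^sub>R x"
    have uu: "cinner u u = 1"
      using \<open>x \<noteq> 0\<close> by (simp add: u_def cinner_self)
    have ue: "cinner u e = 0" "cinner e u = 0" if "e \<in> M" for e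
      using x that cinner_commute[of e u] by (simp_all add: u_def cinner_scaleR_left)
    have "insert u M \<in> A"
      using M(1) uu ue by (auto simp: A_def)
    then have "u \<in> M" using M(2)[of "insert u M"] by blast
    then show False using ue uu by auto
  qed
  have "is_onb M"
    unfolding is_onb_def using M(1)[unfolded A_def] tot by simp
  then show ?thesis by (rule exI)
qed

lemma some_onb: "is_onb some_onb"
  unfolding some_onb_def using onb_exists by (rule someI_ex)

lemma onb_expansion_finite:
  fixes x :: "'h::complex_hilbert"
  assumes B: "is_onb B" and F: "finite F" "F \<subseteq> B"
  defines "S \<equiv> (\<Sum>e\<in>F. cinner x e *\<^sub>C e)"
  shows "e \<in> B \<Longrightarrow> cinner S e = (if e \<in> F then cinner x e else 0)"
    and "(norm S)\<^sup>2 = (\<Sum>e\<in>F. (cmod (cinner x e))\<^sup>2)"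
    and "(\<Sum>e\<in>F. (cmod (cinner x e))\<^sup>2) \<le> (norm x)\<^sup>2"
proof -
  show *: "cinner S e = (if e \<in> F then cinner x e else 0)" if "e \<in> B" for e
  proof -
    have "cinner S e = (\<Sum>f\<in>F. if f = e then cinner x e else 0)"
      unfolding S_def cinner_sum_left
      using B F that by (intro sum.cong) (auto simp: cinner_scaleC_left is_onb_def)
    then show ?thesis using F by simp
  qed
  have xS: "cinner x S = complex_of_real (\<Sum>e\<in>F. (cmod (cinner x e))\<^sup>2)"
    by (simp add: S_def cinner_sum_right cinner_scaleC_right complex_norm_square mult.commute del: of_real_power)
  have "cinner S S = (\<Sum>e\<in>F. cnj (cinner x e) * cinner S e)"
    by (subst (2) S_def) (simp add: cinner_sum_right cinner_scaleC_right)
  also have "\<dots> = cinner x S"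
    unfolding xS using * F by (simp add: complex_norm_square mult.commute subset_iff del: of_real_power)
  finally have SS: "cinner S S = cinner x S" .
  then show n: "(norm S)\<^sup>2 = (\<Sum>e\<in>F. (cmod (cinner x e))\<^sup>2)"
    unfolding xS cinner_self using of_real_eq_iff by blast
  have "(norm S)\<^sup>2 = inner x S"
    using SS by (simp add: Re_cinner[symmetric] cinner_self[symmetric] power2_norm_eq_inner)
  also have "\<dots> \<le> norm x * norm S" by (rule norm_cauchy_schwarz)
  finally have "norm S \<le> norm x"
    by (cases "norm S = 0") (auto simp: power2_eq_square)
  then show "(\<Sum>e\<in>F. (cmod (cinner x e))\<^sup>2) \<le> (norm x)\<^sup>2"
    unfolding n[symmetric] by simp
qed

lemma parseval:
  fixes x :: "'h::complex_hilbert"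
  assumes B: "is_onb B"
  shows "((\<lambda>e. (cmod (cinner x e))\<^sup>2) has_sum (norm x)\<^sup>2) B"
proof -
  define g where "g = (\<lambda>e. (cmod (cinner x e))\<^sup>2)"
  define S where "S = (\<lambda>F. \<Sum>e\<in>F. cinner x e *\<^sub>C e)"
  have g0: "g e \<ge> 0" for e by (simp add: g_def)
  have nS: "(norm (S F))\<^sup>2 = sum g F" and bes: "sum g F \<le> (norm x)\<^sup>2" if "finite F" "F \<subseteq> B" for F
    using onb_expansion_finite(2,3)[OF B that, of x] by (simp_all add: S_def g_def)
  have "g summable_on B"
    by (rule nonneg_bdd_above_summable_on) (auto simp: g0 intro!: bdd_aboveI[of _ "(norm x)\<^sup>2"] bes)
  then obtain s where s: "(g has_sum s) B" by (auto simp: summable_on_def)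
  have le: "sum g F \<le> s" if "finite F" "F \<subseteq> B" for F
    using finite_sum_le_has_sum[OF s that] g0 by auto
  have "\<exists>F. finite F \<and> F \<subseteq> B \<and> dist (sum g F) s \<le> (1 / (real n + 1))\<^sup>2" for n
    by (rule has_sum_finite_approximation[OF s, of "(1 / (real n + 1))\<^sup>2"]) simp_all
  then obtain F where F: "\<And>n. finite (F n)" "\<And>n. F n \<subseteq> B"
      and Fd: "\<And>n. dist (sum g (F n)) s \<le> (1 / (real n + 1))\<^sup>2"
    by metis
  have tail: "sum g G \<le> (1 / (real n + 1))\<^sup>2" if "finite G" "G \<subseteq> B" "G \<inter> F n = {}" for G n
  proof -
    have "sum g (F n) + sum g G = sum g (F n \<union> G)"
      using that F by (subst sum.union_disjoint) auto
    also have "\<dots> \<le> s" using that F by (intro le) auto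
    finally show ?thesis using Fd[of n] by (simp add: dist_real_def)
  qed
  have diff: "norm (S (F n) - S (F m)) \<le> 1 / (real n + 1) + 1 / (real m + 1)" for n m
  proof -
    have eq: "S (F n) - S (F m) = S (F n - F m) - S (F m - F n)"
    proof -
      have "S (F n) = S (F n - F m) + S (F n \<inter> F m)" for n m
        unfolding S_def using sum.Int_Diff[OF F(1)[of n], of _ "F m"] by (simp add: add.commute)
      from this[of n m] this[of m n] show ?thesis by (simp add: Int_commute)
    qed
    have "norm (S (F n - F m)) \<le> 1 / (real m + 1)" for n m
    proof (rule power2_le_imp_le)
      show "(norm (S (F n - F m)))\<^sup>2 \<le> (1 / (real m + 1))\<^sup>2"
        using F by (subst nS) (auto intro!: tail)
    qed simp
    from this[of n m] this[of m n] show ?thesis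
      unfolding eq using norm_triangle_ineq4[of "S (F n - F m)" "S (F m - F n)"] by linarith
  qed
  have z: "(\<lambda>n. 1 / (real n + 1)) \<longlonglongrightarrow> 0"
    using LIMSEQ_inverse_real_of_nat by (simp add: inverse_eq_divide add.commute)
  have "Cauchy (\<lambda>n. S (F n))"
  proof (rule metric_CauchyI)
    fix \<epsilon> :: real assume "\<epsilon> > 0"
    then have "\<forall>\<^sub>F n in sequentially. 1 / (real n + 1) < \<epsilon> / 2"
      using order_tendstoD(2)[OF z, of "\<epsilon> / 2"] by simp
    then obtain N where N: "\<And>n. n \<ge> N \<Longrightarrow> 1 / (real n + 1) < \<epsilon> / 2"
      by (auto simp: eventually_sequentially)
    show "\<exists>N. \<forall>m\<ge>N. \<forall>n\<ge>N. dist (S (F m)) (S (F n)) < \<epsilon>"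
    proof (intro exI allI impI)
      fix m n assume "m \<ge> N" "n \<ge> N"
      then show "dist (S (F m)) (S (F n)) < \<epsilon>"
        using diff[of m n] N[of m] N[of n] by (simp add: dist_norm)
    qed
  qed
  then obtain y where y: "(\<lambda>n. S (F n)) \<longlonglongrightarrow> y"
    using Cauchy_convergent convergent_def by blast
  have "cinner (x - y) e = 0" if e: "e \<in> B" for e
  proof -
    have "(\<lambda>n. cinner (x - S (F n)) e) \<longlonglongrightarrow> cinner (x - y) e"
      by (intro bounded_linear.tendsto[OF bounded_linear_cinner_left] tendsto_intros y)
    moreover have "(\<lambda>n. cinner (x - S (F n)) e) \<longlonglongrightarrow> 0"
    proof (rule Lim_null_comparison[OF always_eventually z], intro allI)
      fix n
      show "norm (cinner (x - S (F n)) e) \<le> 1 / (real n + 1)"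
      proof (cases "e \<in> F n")
        case True
        then show ?thesis
          using onb_expansion_finite(1)[OF B F(1)[of n] F(2)[of n] e, of x] by (simp add: S_def cinner_diff_left)
      next
        case False
        have "(cmod (cinner x e))\<^sup>2 \<le> (1 / (real n + 1))\<^sup>2"
          using tail[of "{e}" n] False e by (simp add: g_def)
        then have "cmod (cinner x e) \<le> 1 / (real n + 1)"
          by (rule power2_le_imp_le) simp
        then show ?thesis
          using False onb_expansion_finite(1)[OF B F(1)[of n] F(2)[of n] e, of x]
          by (simp add: S_def cinner_diff_left)
      qed
    qed
    ultimately show ?thesis by (rule LIMSEQ_unique)
  qed
  then have "x = y" using B unfolding is_onb_def by (metis right_minus_eq)
  have "(\<lambda>n. (norm (S (F n)))\<^sup>2) \<longlonglongrightarrow> (norm x)\<^sup>2"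
    unfolding \<open>x = y\<close> by (intro tendsto_intros y)
  moreover have "(\<lambda>n. (norm (S (F n)))\<^sup>2) \<longlonglongrightarrow> s"
  proof -
    have "(\<lambda>n. sum g (F n)) \<longlonglongrightarrow> s"
    proof (rule Lim_transform2[OF tendsto_const])
      show "(\<lambda>n. s - sum g (F n)) \<longlonglongrightarrow> 0"
      proof (rule Lim_null_comparison[OF always_eventually], intro allI)
        fix n show "norm (s - sum g (F n)) \<le> (1 / (real n + 1))\<^sup>2"
          using Fd[of n] by (simp add: dist_real_def abs_minus_commute)
        show "(\<lambda>n. (1 / (real n + 1))\<^sup>2) \<longlonglongrightarrow> 0"
          using tendsto_power[OF z, of 2] by simp
      qed
    qed
    then show ?thesis using nS F by simp
  qed
  ultimately have "s = (norm x)\<^sup>2" using LIMSEQ_unique by blast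
  then show ?thesis using s by (simp add: g_def)
qed

text \<open>Being Hilbert-Schmidt, and the Hilbert-Schmidt norm, do not depend on the orthonormal basis.\<close>

lemma hs_basis_indep:
  fixes T :: "'h::complex_hilbert \<Rightarrow>\<^sub>L 'h"
  assumes T: "selfadjoint T" and B: "is_onb B" and C: "is_onb C"
    and s: "((\<lambda>e. (norm (T e))\<^sup>2) has_sum s) B"
  shows "((\<lambda>e. (norm (T e))\<^sup>2) has_sum s) C"
proof -
  define f where "f = (\<lambda>(b,c). (cmod (cinner (T b) c))\<^sup>2)"
  have f1: "((\<lambda>c. f (b, c)) has_sum (norm (T b))\<^sup>2) C" for b
    using parseval[OF C, of "T b"] by (simp add: f_def)
  have "cmod (cinner (T b) c) = cmod (cinner (T c) b)" for b c
    using T cinner_commute[of b "T c"] by (simp add: selfadjoint_def)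
  then have f2: "((\<lambda>b. f (b, c)) has_sum (norm (T c))\<^sup>2) B" for c
    using parseval[OF B, of "T c"] by (simp add: f_def)
  have "f summable_on (B \<times> C)"
    by (rule summable_on_SigmaI[OF f1 has_sum_imp_summable[OF s]]) (auto simp: f_def)
  then have "(f has_sum s) (B \<times> C)"
    by (rule has_sum_SigmaI[OF f1 s])
  then have "((\<lambda>(x,y). f (y,x)) has_sum s) (C \<times> B)"
    by (simp only: has_sum_swap[of f])
  then show ?thesis
    by (rule has_sum_SigmaD) (use f2 in simp)
qed

lemma HSh_summable: "a \<in> HSh \<Longrightarrow> (\<lambda>e. (norm (a e))\<^sup>2) summable_on some_onb"
  by (simp add: HSh_def HS_def)

lemma adj_op_selfadjoint:
  assumes "selfadjoint a"
  shows "adj_op a = a"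
  unfolding adj_op_def
proof (rule the_equality)
  show "\<forall>x y. cinner (a x) y = cinner x (a y)"
    using assms by (simp add: selfadjoint_def)
  fix S :: "'a \<Rightarrow>\<^sub>L 'a"
  assume S: "\<forall>x y. cinner (a x) y = cinner x (S y)"
  show "S = a"
  proof (rule blinfun_eqI)
    fix y
    have "cinner (S y - a y) (S y - a y) = 0"
      using S assms by (simp add: cinner_diff_right selfadjoint_def)
    then show "S y = a y" by (simp add: cinner_self)
  qed
qed

lemma HSh_zero: "0 \<in> HSh"
  by (simp add: HSh_def HS_def complex_linear_def selfadjoint_def)
    (metis cinner_scaleC_left cinner_self mult_zero_left norm_zero norm_scaleC mult_zero_right norm_eq_zero)

lemma HSh_add: "a + b \<in> HSh" if a: "a \<in> HSh" and b: "b \<in> HSh"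
proof -
  have "(\<lambda>e. (norm (a e + b e))\<^sup>2) summable_on some_onb"
  proof (rule summable_on_comparison_test)
    show "(\<lambda>e. 2 * ((norm (a e))\<^sup>2 + (norm (b e))\<^sup>2)) summable_on some_onb"
      by (intro summable_on_cmult_right summable_on_add HSh_summable a b)
    fix e
    have "(norm (a e + b e))\<^sup>2 \<le> (norm (a e) + norm (b e))\<^sup>2"
      by (intro power_mono norm_triangle_ineq) simp
    also have "\<dots> \<le> 2 * ((norm (a e))\<^sup>2 + (norm (b e))\<^sup>2)"
      using sum_squares_bound[of "norm (a e)" "norm (b e)"] by (simp add: power2_sum)
    finally show "(norm (a e + b e))\<^sup>2 \<le> 2 * ((norm (a e))\<^sup>2 + (norm (b e))\<^sup>2)" .
  qed simp
  then show ?thesis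
    using a b by (simp add: HSh_def HS_def complex_linear_def selfadjoint_def blinfun.bilinear_simps
      cinner_add_left cinner_add_right scaleC_add_right)
qed

lemma HSh_scaleR: "r *\<^sub>R a \<in> HSh" if a: "a \<in> HSh"
proof -
  have "(\<lambda>e. (norm (r *\<^sub>R a e))\<^sup>2) summable_on some_onb"
    unfolding norm_scaleR power_mult_distrib
    by (intro summable_on_cmult_right HSh_summable a)
  then show ?thesis
    using a by (simp add: HSh_def HS_def complex_linear_def selfadjoint_def blinfun.bilinear_simps
      cinner_scaleC_left cinner_scaleC_right scaleR_scaleC scaleC_scaleC mult.commute)
qed

lemma HSh_minus: "a \<in> HSh \<Longrightarrow> - a \<in> HSh"
  using HSh_scaleR[of a "-1"] by simp

lemma HSh_diff: "a \<in> HSh \<Longrightarrow> b \<in> HSh \<Longrightarrow> a - b \<in> HSh"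
  using HSh_add[of a "-b"] HSh_minus[of b] by simp

lemma HSh_inner_summable:
  assumes a: "a \<in> HSh" and b: "b \<in> HSh"
  shows "(\<lambda>e. norm (cinner (a e) (b e))) summable_on some_onb"
proof (rule summable_on_comparison_test)
  show "(\<lambda>e. (norm (a e))\<^sup>2 + (norm (b e))\<^sup>2) summable_on some_onb"
    by (intro summable_on_add HSh_summable a b)
  fix e
  have "cmod (cinner (a e) (b e)) \<le> norm (a e) * norm (b e)" by (rule cmod_cinner_le)
  also have "\<dots> \<le> (norm (a e))\<^sup>2 + (norm (b e))\<^sup>2"
    using sum_squares_bound[of "norm (a e)" "norm (b e)"]
      mult_nonneg_nonneg[OF norm_ge_zero[of "a e"] norm_ge_zero[of "b e"]] by linarith
  finally show "cmod (cinner (a e) (b e)) \<le> (norm (a e))\<^sup>2 + (norm (b e))\<^sup>2" .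
qed simp

definition hs_ip :: "('h::complex_hilbert \<Rightarrow>\<^sub>L 'h) \<Rightarrow> ('h \<Rightarrow>\<^sub>L 'h) \<Rightarrow> real" where
  "hs_ip a b = (\<Sum>\<^sub>\<infinity>e\<in>some_onb. inner (a e) (b e))"

lemma hs_ip_summable:
  assumes a: "a \<in> HSh" and b: "b \<in> HSh"
  shows "(\<lambda>e. inner (a e) (b e)) summable_on some_onb"
  using summable_on_Re[OF abs_summable_summable[OF HSh_inner_summable[OF a b]]] by (simp add: Re_cinner)

lemma trace_HSh:
  assumes a: "a \<in> HSh" and b: "b \<in> HSh"
  shows "Re (trace_op (a o\<^sub>L adj_op b)) = hs_ip a b"
proof -
  have "cinner ((a o\<^sub>L adj_op b) e) e = cinner (b e) (a e)" for e
    using a b by (simp add: adj_op_selfadjoint HSh_def selfadjoint_def)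
  then have "Re (trace_op (a o\<^sub>L adj_op b)) = Re (\<Sum>\<^sub>\<infinity>e\<in>some_onb. cinner (b e) (a e))"
    by (simp add: trace_op_def)
  also have "\<dots> = (\<Sum>\<^sub>\<infinity>e\<in>some_onb. inner (b e) (a e))"
    using infsum_Re[OF abs_summable_summable[OF HSh_inner_summable[OF b a]]] by (simp add: Re_cinner)
  finally show ?thesis by (simp add: hs_ip_def inner_commute)
qed

lemma hs_ip_commute: "hs_ip a b = hs_ip b a"
  by (simp add: hs_ip_def inner_commute)

lemma hs_ip_add_left: "a \<in> HSh \<Longrightarrow> b \<in> HSh \<Longrightarrow> c \<in> HSh \<Longrightarrow> hs_ip (a + b) c = hs_ip a c + hs_ip b c"
  by (simp add: hs_ip_def blinfun.bilinear_simps inner_add_left infsum_add hs_ip_summable)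

lemma hs_ip_scaleR_left: "hs_ip (r *\<^sub>R a) c = r * hs_ip a c"
  by (simp add: hs_ip_def blinfun.bilinear_simps infsum_cmult_right')

lemma hs_ip_self: "hs_ip a a = (\<Sum>\<^sub>\<infinity>e\<in>some_onb. (norm (a e))\<^sup>2)"
  by (simp add: hs_ip_def power2_norm_eq_inner)

lemma hs_ip_ge_zero: "0 \<le> hs_ip a a"
  unfolding hs_ip_self by (rule infsum_nonneg) simp

lemma norm_le_hs:
  assumes a: "a \<in> HSh"
  shows "(norm a)\<^sup>2 \<le> hs_ip a a"
proof -
  have sa: "selfadjoint a" using a by (simp add: HSh_def)
  have "norm a \<le> sqrt (hs_ip a a)"
  proof (rule norm_blinfun_bound)
    fix x
    have p: "((\<lambda>e. (cmod (cinner (a x) e))\<^sup>2) has_sum (norm (a x))\<^sup>2) some_onb"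
      by (rule parseval[OF some_onb])
    have q: "((\<lambda>e. (norm x)\<^sup>2 * (norm (a e))\<^sup>2) has_sum (norm x)\<^sup>2 * hs_ip a a) some_onb"
      unfolding hs_ip_self by (intro has_sum_cmult_right has_sum_infsum HSh_summable a)
    have "(norm (a x))\<^sup>2 \<le> (norm x)\<^sup>2 * hs_ip a a"
    proof (rule has_sum_mono[OF p q])
      fix e
      have "(cmod (cinner x (a e)))\<^sup>2 \<le> (norm x * norm (a e))\<^sup>2"
        by (intro power_mono cmod_cinner_le) simp
      then show "(cmod (cinner (a x) e))\<^sup>2 \<le> (norm x)\<^sup>2 * (norm (a e))\<^sup>2"
        using sa by (simp add: selfadjoint_def power_mult_distrib)
    qed
    then have "sqrt ((norm (a x))\<^sup>2) \<le> sqrt ((norm x)\<^sup>2 * hs_ip a a)"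
      by (rule real_sqrt_le_mono)
    then show "norm (a x) \<le> sqrt (hs_ip a a) * norm x"
      by (simp add: real_sqrt_mult mult.commute)
  qed (simp add: hs_ip_ge_zero)
  then have "(norm a)\<^sup>2 \<le> (sqrt (hs_ip a a))\<^sup>2"
    by (intro power_mono) simp_all
  then show ?thesis by (simp add: hs_ip_ge_zero)
qed

lemma hs_ip_eq_zero: "a \<in> HSh \<Longrightarrow> hs_ip a a = 0 \<Longrightarrow> a = 0"
  using norm_le_hs[of a] by simp

lemma infinite_some_onb: "infinite (some_onb :: 'h::inf_sep_complex_hilbert set)"
proof
  assume fin: "finite (some_onb :: 'h set)"
  obtain x :: 'h where x: "\<And>c. x \<noteq> (\<Sum>v\<in>some_onb. c v *\<^sub>C v)"
    using infinite_dim[OF fin] by blast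
  define S where "S = (\<Sum>e\<in>some_onb. cinner x e *\<^sub>C e)"
  have "cinner (x - S) e = 0" if "e \<in> some_onb" for e
    using onb_expansion_finite(1)[OF some_onb fin order.refl that, of x] that
    by (simp add: S_def cinner_diff_left)
  then have "x = S" using some_onb unfolding is_onb_def by (metis right_minus_eq)
  then show False using x unfolding S_def by blast
qed

lemma id_notin_HSh:
  assumes "r *\<^sub>R id_blinfun \<in> (HSh :: ('h::inf_sep_complex_hilbert \<Rightarrow>\<^sub>L 'h) set)"
  shows "r = 0"
proof (rule ccontr)
  assume "r \<noteq> 0"
  have n: "norm e = 1" if "e \<in> some_onb" for e :: 'h
  proof -
    have "complex_of_real ((norm e)\<^sup>2) = 1"
      using some_onb that unfolding is_onb_def cinner_self[symmetric] by auto
    then have "(norm e)\<^sup>2 = 1" using of_real_eq_1_iff by blast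
    then show ?thesis by (metis norm_ge_zero power2_eq_1_iff not_one_le_zero le_minus_one_simps(3))
  qed
  have "(\<lambda>e::'h. (norm ((r *\<^sub>R id_blinfun :: 'h \<Rightarrow>\<^sub>L 'h) e))\<^sup>2) summable_on some_onb"
    by (rule HSh_summable[OF assms])
  then have "(\<lambda>e::'h. r\<^sup>2) summable_on some_onb"
    by (rule summable_on_cong[THEN iffD1, rotated]) (simp add: blinfun.bilinear_simps n)
  then show False
    using infsum_diverge_constant[OF infinite_some_onb[where 'h='h], of "r\<^sup>2"] \<open>r \<noteq> 0\<close> by simp
qed

lemma HR_decomp_unique:
  fixes a b :: "'h::inf_sep_complex_hilbert \<Rightarrow>\<^sub>L 'h"
  assumes "a \<in> HSh" "b \<in> HSh" "a + l *\<^sub>R id_blinfun = b + m *\<^sub>R id_blinfun"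
  shows "a = b \<and> l = m"
proof -
  have "(l - m) *\<^sub>R id_blinfun = b - a"
    using assms(3) by (simp add: algebra_simps)
  then have "(l - m) *\<^sub>R (id_blinfun :: 'h \<Rightarrow>\<^sub>L 'h) \<in> HSh"
    using HSh_diff assms by metis
  then have "l = m" using id_notin_HSh[of "l - m"] by auto
  then show ?thesis using assms by simp
qed


section \<open>The real Hilbert space of operators \<open>a + \<lambda>\<close>\<close>

typedef (overloaded) 'h HR =
  "{a + l *\<^sub>R id_blinfun | (a :: 'h::inf_sep_complex_hilbert \<Rightarrow>\<^sub>L 'h) l. a \<in> HSh}"
  morphisms op_of HR_of
  using HSh_zero by blast

text \<open>The components of \<open>a + \<lambda>\<close> are unique by lemma \<open>HR_decomp_unique\<close>.\<close>

definition hs_part :: "'h::inf_sep_complex_hilbert HR \<Rightarrow> ('h \<Rightarrow>\<^sub>L 'h)" where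
  "hs_part p = (THE a. a \<in> HSh \<and> (\<exists>l. op_of p = a + l *\<^sub>R id_blinfun))"

definition sc_part :: "'h::inf_sep_complex_hilbert HR \<Rightarrow> real" where
  "sc_part p = (THE l. \<exists>a\<in>HSh. op_of p = a + l *\<^sub>R id_blinfun)"

lemma parts_eq:
  assumes "a \<in> HSh" "op_of p = a + l *\<^sub>R id_blinfun"
  shows "hs_part p = a" "sc_part p = l"
  unfolding hs_part_def sc_part_def using assms
  by (auto intro!: the_equality dest: HR_decomp_unique)

lemma
  shows hs_part_HSh [simp]: "hs_part p \<in> HSh"
    and op_of_parts: "op_of p = hs_part p + sc_part p *\<^sub>R id_blinfun"
proof -
  obtain a l where "a \<in> HSh" "op_of p = a + l *\<^sub>R id_blinfun"
    using op_of[of p] by blast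
  with parts_eq[OF this] show "hs_part p \<in> HSh" "op_of p = hs_part p + sc_part p *\<^sub>R id_blinfun"
    by simp_all
qed

lemma op_of_HR_of:
  "a \<in> HSh \<Longrightarrow> T = a + l *\<^sub>R id_blinfun \<Longrightarrow> op_of (HR_of T) = T"
  by (rule HR_of_inverse) blast

instantiation HR :: (inf_sep_complex_hilbert) real_vector
begin

definition "0 = HR_of 0"
definition "p + q = HR_of (op_of p + op_of q)"
definition "- p = HR_of (- op_of p)"
definition "p - q = HR_of (op_of p - op_of q)"
definition "r *\<^sub>R p = HR_of (r *\<^sub>R op_of p)"

lemma op_of_zero [simp]: "op_of 0 = 0"
  unfolding zero_HR_def by (rule op_of_HR_of[OF HSh_zero, where l=0]) simp

lemma op_of_add [simp]: "op_of (p + q) = op_of p + op_of q"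
  unfolding plus_HR_def
  by (rule op_of_HR_of[OF HSh_add[OF hs_part_HSh[of p] hs_part_HSh[of q]], where l="sc_part p + sc_part q"])
    (simp add: op_of_parts[of p] op_of_parts[of q] scaleR_add_left)

lemma op_of_minus [simp]: "op_of (- p) = - op_of p"
  unfolding uminus_HR_def
  by (rule op_of_HR_of[OF HSh_minus[OF hs_part_HSh[of p]], where l="- sc_part p"])
    (simp add: op_of_parts[of p])

lemma op_of_diff [simp]: "op_of (p - q) = op_of p - op_of q"
  unfolding minus_HR_def
  by (rule op_of_HR_of[OF HSh_diff[OF hs_part_HSh[of p] hs_part_HSh[of q]], where l="sc_part p - sc_part q"])
    (simp add: op_of_parts[of p] op_of_parts[of q] scaleR_diff_left)

lemma op_of_scaleR [simp]: "op_of (r *\<^sub>R p) = r *\<^sub>R op_of p"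
  unfolding scaleR_HR_def
  by (rule op_of_HR_of[OF HSh_scaleR[OF hs_part_HSh[of p], of r], where l="r * sc_part p"])
    (simp add: op_of_parts[of p] scaleR_add_right)

instance
  by standard (simp_all add: op_of_inject[symmetric] algebra_simps)

end

lemma hs_part_add: "hs_part (p + q) = hs_part p + hs_part q"
  and sc_part_add: "sc_part (p + q) = sc_part p + sc_part q"
proof -
  have "op_of (p + q) = (hs_part p + hs_part q) + (sc_part p + sc_part q) *\<^sub>R id_blinfun"
    by (simp add: op_of_parts[of p] op_of_parts[of q] scaleR_add_left)
  from parts_eq[OF HSh_add[OF hs_part_HSh hs_part_HSh] this]
  show "hs_part (p + q) = hs_part p + hs_part q" "sc_part (p + q) = sc_part p + sc_part q" .
qed

lemma hs_part_scaleR: "hs_part (r *\<^sub>R p) = r *\<^sub>R hs_part p"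
  and sc_part_scaleR: "sc_part (r *\<^sub>R p) = r * sc_part p"
proof -
  have "op_of (r *\<^sub>R p) = r *\<^sub>R hs_part p + (r * sc_part p) *\<^sub>R id_blinfun"
    by (simp add: op_of_parts[of p] scaleR_add_right)
  from parts_eq[OF HSh_scaleR[OF hs_part_HSh] this]
  show "hs_part (r *\<^sub>R p) = r *\<^sub>R hs_part p" "sc_part (r *\<^sub>R p) = r * sc_part p" .
qed

lemma hs_part_diff: "hs_part (p - q) = hs_part p - hs_part q"
  and sc_part_diff: "sc_part (p - q) = sc_part p - sc_part q"
  using hs_part_add[of "p - q" q] sc_part_add[of "p - q" q] by simp_all

text \<open>For self-adjoint Hilbert-Schmidt \<open>a\<close>, \<open>b\<close> the number \<open>tr(ab\<^sup>*)\<close> is real, so that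
  taking its real part below only changes the type.\<close>

instantiation HR :: (inf_sep_complex_hilbert) real_inner
begin

definition inner_HR :: "'a HR \<Rightarrow> 'a HR \<Rightarrow> real" where
  "inner_HR p q = 4 * Re (trace_op (hs_part p o\<^sub>L adj_op (hs_part q))) + sc_part p * sc_part q"

definition norm_HR :: "'a HR \<Rightarrow> real" where
  "norm_HR p = sqrt (inner p p)"

definition sgn_HR :: "'a HR \<Rightarrow> 'a HR" where
  "sgn_HR p = inverse (norm p) *\<^sub>R p"

definition dist_HR :: "'a HR \<Rightarrow> 'a HR \<Rightarrow> real" where
  "dist_HR p q = norm (p - q)"

definition uniformity_HR :: "('a HR \<times> 'a HR) filter" where
  "uniformity_HR = (INF e\<in>{0<..}. principal {(x, y). dist x y < e})"

definition open_HR :: "'a HR set \<Rightarrow> bool" where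
  "open_HR U \<longleftrightarrow> (\<forall>x\<in>U. eventually (\<lambda>(x', y). x' = x \<longrightarrow> y \<in> U) uniformity)"

lemma inner_HR_eq: "inner p q = 4 * hs_ip (hs_part p) (hs_part q) + sc_part p * sc_part (q :: 'a HR)"
  by (simp add: inner_HR_def trace_HSh)

instance
proof
  fix x y z :: "'a HR" and r :: real and U :: "'a HR set"
  show "inner x y = inner y x"
    by (simp add: inner_HR_eq hs_ip_commute mult.commute)
  show "inner (x + y) z = inner x z + inner y z"
    by (simp add: inner_HR_eq hs_part_add sc_part_add hs_ip_add_left algebra_simps)
  show "inner (r *\<^sub>R x) y = r * inner x y"
    by (simp add: inner_HR_eq hs_part_scaleR sc_part_scaleR hs_ip_scaleR_left algebra_simps)
  show "0 \<le> inner x x"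
    by (simp add: inner_HR_eq hs_ip_ge_zero)
  show "inner x x = 0 \<longleftrightarrow> x = 0"
  proof
    assume "inner x x = 0"
    then have "hs_ip (hs_part x) (hs_part x) = 0 \<and> sc_part x * sc_part x = 0"
      using hs_ip_ge_zero[of "hs_part x"] zero_le_square[of "sc_part x"]
      unfolding inner_HR_eq by linarith
    then have "op_of x = 0"
      using hs_ip_eq_zero[of "hs_part x"] op_of_parts[of x] by simp
    then show "x = 0" by (simp add: op_of_inject[symmetric])
  next
    assume "x = 0"
    then have "hs_part x = 0" "sc_part x = 0"
      using hs_part_scaleR[of 0 x] sc_part_scaleR[of 0 x] by simp_all
    then show "inner x x = 0" by (simp add: inner_HR_eq hs_ip_def)
  qed
qed (rule norm_HR_def sgn_HR_def dist_HR_def uniformity_HR_def open_HR_def)+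

end

lemma norm_HR_sq: "(norm p)\<^sup>2 = 4 * hs_ip (hs_part p) (hs_part p) + (sc_part p)\<^sup>2"
  unfolding power2_norm_eq_inner inner_HR_eq by (simp add: power2_eq_square)

lemma sc_part_le: "\<bar>sc_part p\<bar> \<le> norm p"
proof (rule power2_le_imp_le)
  show "\<bar>sc_part p\<bar>\<^sup>2 \<le> (norm p)\<^sup>2"
    using norm_HR_sq[of p] hs_ip_ge_zero[of "hs_part p"] by simp
qed simp

lemma hs_ip_le: "hs_ip (hs_part p) (hs_part p) \<le> (norm p)\<^sup>2"
  using norm_HR_sq[of p] hs_ip_ge_zero[of "hs_part p"] zero_le_power2[of "sc_part p"] by linarith

lemma hs_part_le: "norm (hs_part p) \<le> norm p"
  using order_trans[OF norm_le_hs[OF hs_part_HSh, of p] hs_ip_le[of p]] norm_ge_zero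
  by (rule power2_le_imp_le)

instance HR :: (inf_sep_complex_hilbert) complete_space
proof
  fix X :: "nat \<Rightarrow> 'a HR"
  assume X: "Cauchy X"
  have dd: "norm (hs_part (X m) - hs_part (X n)) \<le> dist (X m) (X n)"
    "dist (sc_part (X m)) (sc_part (X n)) \<le> dist (X m) (X n)" for m n
    using hs_part_le[of "X m - X n"] sc_part_le[of "X m - X n"]
    by (simp_all add: hs_part_diff sc_part_diff dist_norm)
  have "Cauchy (\<lambda>n. hs_part (X n))" "Cauchy (\<lambda>n. sc_part (X n))"
    using X dd unfolding Cauchy_def dist_norm by (meson order.strict_trans1)+
  then obtain a l where a: "(\<lambda>n. hs_part (X n)) \<longlonglongrightarrow> a" and l: "(\<lambda>n. sc_part (X n)) \<longlonglongrightarrow> l"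
    using Cauchy_convergent convergent_def by metis
  have ax: "(\<lambda>n. hs_part (X n) x) \<longlonglongrightarrow> a x" for x
    by (intro blinfun.tendsto a tendsto_const)
  have cl: "complex_linear (hs_part (X n))" and sa: "selfadjoint (hs_part (X n))" for n
    using hs_part_HSh[of "X n"] by (simp_all add: HSh_def HS_def del: hs_part_HSh)
  have acl: "complex_linear a"
    unfolding complex_linear_def
  proof (intro allI)
    fix c x
    have "(\<lambda>n. c *\<^sub>C hs_part (X n) x) \<longlonglongrightarrow> c *\<^sub>C a x"
      by (rule bounded_linear.tendsto[OF bounded_linear_scaleC ax])
    moreover have "(\<lambda>n. c *\<^sub>C hs_part (X n) x) \<longlonglongrightarrow> a (c *\<^sub>C x)"
      using ax[of "c *\<^sub>C x"] cl by (simp add: complex_linear_def)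
    ultimately show "a (c *\<^sub>C x) = c *\<^sub>C a x" by (rule LIMSEQ_unique[symmetric])
  qed
  have asa: "selfadjoint a"
    unfolding selfadjoint_def
  proof (intro allI)
    fix x y
    have "(\<lambda>n. cinner (hs_part (X n) x) y) \<longlonglongrightarrow> cinner (a x) y"
      by (rule bounded_linear.tendsto[OF bounded_linear_cinner_left ax])
    moreover have "(\<lambda>n. cinner (hs_part (X n) x) y) \<longlonglongrightarrow> cinner x (a y)"
      using bounded_linear.tendsto[OF bounded_linear_cinner_right ax] sa
      by (simp add: selfadjoint_def)
    ultimately show "cinner (a x) y = cinner x (a y)" by (rule LIMSEQ_unique)
  qed
  have fin: "(\<Sum>e\<in>F. (norm (hs_part p e))\<^sup>2) \<le> (norm p)\<^sup>2"
    if "finite F" "F \<subseteq> some_onb" for F and p :: "'a HR"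
    using finite_sum_le_infsum[OF HSh_summable[OF hs_part_HSh[of p]] that] hs_ip_le[of p]
    by (simp add: hs_ip_self)
  have lim: "(\<Sum>e\<in>F. (norm (hs_part (X n) e - a e))\<^sup>2) \<le> \<epsilon>\<^sup>2"
    if F: "finite F" "F \<subseteq> some_onb" and N: "\<And>m. m \<ge> N \<Longrightarrow> dist (X n) (X m) \<le> \<epsilon>" for F n N and \<epsilon> :: real
  proof (rule tendsto_upperbound)
    show "(\<lambda>m. \<Sum>e\<in>F. (norm (hs_part (X n) e - hs_part (X m) e))\<^sup>2) \<longlonglongrightarrow>
        (\<Sum>e\<in>F. (norm (hs_part (X n) e - a e))\<^sup>2)"
      by (intro tendsto_intros ax)
    have "(\<Sum>e\<in>F. (norm (hs_part (X n) e - hs_part (X m) e))\<^sup>2) \<le> \<epsilon>\<^sup>2" if "m \<ge> N" for m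
    proof -
      have "(\<Sum>e\<in>F. (norm (hs_part (X n) e - hs_part (X m) e))\<^sup>2) \<le> (norm (X n - X m))\<^sup>2"
        using fin[OF F, of "X n - X m"] by (simp add: hs_part_diff blinfun.bilinear_simps)
      also have "\<dots> \<le> \<epsilon>\<^sup>2"
        using N[OF that] by (intro power_mono) (simp_all add: dist_norm)
      finally show ?thesis .
    qed
    then show "\<forall>\<^sub>F m in sequentially. (\<Sum>e\<in>F. (norm (hs_part (X n) e - hs_part (X m) e))\<^sup>2) \<le> \<epsilon>\<^sup>2"
      by (auto simp: eventually_sequentially)
  qed simp
  have ex: "\<exists>N. \<forall>n\<ge>N. \<forall>m\<ge>N. dist (X n) (X m) \<le> \<epsilon>" if "\<epsilon> > 0" for \<epsilon>
    using X that unfolding Cauchy_def by (meson less_imp_le)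
  have aHS: "a \<in> HSh"
  proof -
    obtain N where N: "\<And>n m. n \<ge> N \<Longrightarrow> m \<ge> N \<Longrightarrow> dist (X n) (X m) \<le> 1"
      using ex[of 1] by auto
    have "(\<lambda>e. (norm (hs_part (X N) e - a e))\<^sup>2) summable_on some_onb"
      by (rule nonneg_bdd_above_summable_on)
        (auto intro!: bdd_aboveI[of _ "1\<^sup>2"] lim[where N=N] N)
    then have "hs_part (X N) - a \<in> HSh"
      using acl asa cl[of N] sa[of N]
      by (simp add: HSh_def HS_def complex_linear_def selfadjoint_def blinfun.bilinear_simps
          cinner_diff_left cinner_diff_right scaleC_diff_right)
    from HSh_diff[OF hs_part_HSh[of "X N"] this] show ?thesis by simp
  qed
  define p where "p = HR_of (a + l *\<^sub>R id_blinfun)"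
  have "op_of p = a + l *\<^sub>R id_blinfun"
    unfolding p_def by (rule op_of_HR_of[OF aHS refl])
  note pp = parts_eq[OF aHS this]
  have hsl: "(\<lambda>n. hs_ip (hs_part (X n - p)) (hs_part (X n - p))) \<longlonglongrightarrow> 0"
  proof (rule LIMSEQ_I)
    fix r :: real assume r: "r > 0"
    define \<epsilon> where "\<epsilon> = sqrt (r / 2)"
    have \<epsilon>: "\<epsilon> > 0" "\<epsilon>\<^sup>2 = r / 2" using r by (simp_all add: \<epsilon>_def)
    obtain N where N: "\<And>n m. n \<ge> N \<Longrightarrow> m \<ge> N \<Longrightarrow> dist (X n) (X m) \<le> \<epsilon>"
      using ex[OF \<epsilon>(1)] by blast
    have "norm (hs_ip (hs_part (X n - p)) (hs_part (X n - p)) - 0) < r" if "n \<ge> N" for n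
    proof -
      have "hs_ip (hs_part (X n - p)) (hs_part (X n - p)) \<le> \<epsilon>\<^sup>2"
        unfolding hs_ip_self
      proof (rule infsum_le_finite_sums[OF HSh_summable[OF hs_part_HSh]])
        fix F :: "'a set" assume "finite F" "F \<subseteq> some_onb"
        then show "(\<Sum>e\<in>F. (norm (hs_part (X n - p) e))\<^sup>2) \<le> \<epsilon>\<^sup>2"
          using lim[of F N n \<epsilon>] N that by (simp add: hs_part_diff pp blinfun.bilinear_simps)
      qed
      then show ?thesis
        using \<epsilon> r hs_ip_ge_zero[of "hs_part (X n - p)"] by simp
    qed
    then show "\<exists>N. \<forall>n\<ge>N. norm (hs_ip (hs_part (X n - p)) (hs_part (X n - p)) - 0) < r"
      by blast
  qed
  have "(\<lambda>n. (norm (X n - p))\<^sup>2) \<longlonglongrightarrow> 4 * 0 + (l - l)\<^sup>2"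
    unfolding norm_HR_sq sc_part_diff pp by (intro tendsto_intros hsl l)
  then have "(\<lambda>n. sqrt ((norm (X n - p))\<^sup>2)) \<longlonglongrightarrow> sqrt 0"
    by (intro tendsto_real_sqrt) simp
  then have "(\<lambda>n. dist (X n) p) \<longlonglongrightarrow> 0"
    by (simp add: dist_norm)
  then show "convergent X"
    unfolding convergent_def using tendsto_dist_iff by blast
qed


section \<open>Submanifolds of open subsets of a real Hilbert space\<close>

definition bounded_multilinear :: "nat \<Rightarrow> ('a::real_normed_vector list \<Rightarrow> 'b::real_normed_vector) \<Rightarrow> bool" where
  "bounded_multilinear k m \<longleftrightarrow>
     (\<forall>us vs. length us + length vs + 1 = k \<longrightarrow> linear (\<lambda>v. m (us @ v # vs))) \<and>
     (\<exists>K. \<forall>vs. length vs = k \<longrightarrow> norm (m vs) \<le> K * prod_list (map norm vs))"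

text \<open>\<open>smooth_on U f\<close>: \<open>f\<close> is infinitely often Frechet differentiable on the open set \<open>U\<close>. The witness
  \<open>D k x\<close> is the \<open>k\<close>-th derivative at \<open>x\<close>, as a bounded \<open>k\<close>-linear map on lists of length \<open>k\<close>; the
  last clause says that \<open>D (Suc k) x\<close> is the Frechet derivative of \<open>D k\<close> at \<open>x\<close> with respect to the
  operator norm on \<open>k\<close>-linear maps.\<close>

definition smooth_on :: "'a::real_normed_vector set \<Rightarrow> ('a \<Rightarrow> 'b::real_normed_vector) \<Rightarrow> bool" where
  "smooth_on U f \<longleftrightarrow> open U \<and> (\<exists>D :: nat \<Rightarrow> 'a \<Rightarrow> 'a list \<Rightarrow> 'b. \<forall>x\<in>U.
     D 0 x [] = f x \<and>
     (\<forall>k. bounded_multilinear k (D k x) \<and>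
       (\<forall>\<epsilon>>0. \<exists>\<delta>>0. \<forall>y\<in>U. norm (y - x) < \<delta> \<longrightarrow>
         (\<forall>vs. length vs = k \<longrightarrow>
           norm (D k y vs - D k x vs - D (Suc k) x ((y - x) # vs))
             \<le> \<epsilon> * norm (y - x) * prod_list (map norm vs)))))"

definition diffeo_on :: "'a::real_normed_vector set \<Rightarrow> ('a \<Rightarrow> 'b::real_normed_vector) \<Rightarrow> bool" where
  "diffeo_on U \<phi> \<longleftrightarrow> smooth_on U \<phi> \<and> inj_on \<phi> U \<and> smooth_on (\<phi> ` U) (the_inv_into U \<phi>)"

text \<open>Embedded submanifolds, through slice charts. In a Hilbert space every closed subspace is
  complemented, so no splitting condition is needed.\<close>

definition submanifold_of :: "'a::{real_inner, complete_space} set \<Rightarrow> 'a set \<Rightarrow> bool" where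
  "submanifold_of M \<Omega> \<longleftrightarrow> M \<subseteq> \<Omega> \<and> open \<Omega> \<and>
     (\<forall>p\<in>M. \<exists>U \<phi> F. p \<in> U \<and> U \<subseteq> \<Omega> \<and> diffeo_on U (\<phi> :: 'a \<Rightarrow> 'a) \<and> subspace F \<and> closed F \<and>
        \<phi> ` (U \<inter> M) = \<phi> ` U \<inter> F)"

definition closed_submanifold_of :: "'a::{real_inner, complete_space} set \<Rightarrow> 'a set \<Rightarrow> bool" where
  "closed_submanifold_of M \<Omega> \<longleftrightarrow> submanifold_of M \<Omega> \<and> closedin (top_of_set \<Omega>) M"


section \<open>Positive invertible operators, geodesics and leaves\<close>

definition Sigma_pos :: "'h::inf_sep_complex_hilbert HR set" where
  "Sigma_pos = {p. positive_op (op_of p) \<and> invertible_op (op_of p)}"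

definition geodesic :: "'h::inf_sep_complex_hilbert HR \<Rightarrow> 'h HR \<Rightarrow> real \<Rightarrow> ('h \<Rightarrow>\<^sub>L 'h)" where
  "geodesic p q t = op_powr (op_of p) (1/2) o\<^sub>L
     op_powr (op_powr (op_of p) (-1/2) o\<^sub>L op_of q o\<^sub>L op_powr (op_of p) (-1/2)) t o\<^sub>L
     op_powr (op_of p) (1/2)"

definition geodesically_convex :: "'h::inf_sep_complex_hilbert HR set \<Rightarrow> bool" where
  "geodesically_convex M \<longleftrightarrow> M \<subseteq> Sigma_pos \<and>
     (\<forall>p\<in>M. \<forall>q\<in>M. geodesic p q ` {0..1} \<subseteq> op_of ` M)"

definition leaf :: "real \<Rightarrow> 'h::inf_sep_complex_hilbert HR set" where
  "leaf l = {p \<in> Sigma_pos. \<exists>a\<in>HSh. op_of p = a + l *\<^sub>R id_blinfun}"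

end

theory Submission
  imports Defs "HOL-Computational_Algebra.Fundamental_Theorem_Algebra"
begin

text \<open>The leaf \<open>\<Sigma>\<^sub>\<lambda>\<close> is the intersection of the cone \<open>\<Sigma>\<close> with a level set of the continuous linear
  functional that sends \<open>a + \<lambda>\<close> to \<open>\<lambda>\<close>. Since \<open>\<Sigma>\<close> is open (\<open>open_Sigma_pos\<close>), the leaf is an open piece of a
  closed affine hyperplane; one translation flattens it to a closed subspace, and it is relatively closed
  (\<open>closed_submanifold_of_translate\<close>).

  Geodesic convexity rests on the fact that taking the scalar part is compatible with products and with the
  functional calculus: Hilbert-Schmidt operators form an ideal, so modulo this ideal an operator \<open>m + a\<close>
  behaves like the number \<open>m\<close>. For a symmetric product this is \<open>HSh_sandwich\<close>; for a function \<open>f\<close> that is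
  continuous on an interval around the spectrum and differentiable at \<open>m\<close> it is \<open>fun_calc_HSh\<close>, which follows from
  \<open>f(T) - f(m) = g(T) (T - m)\<close> with the difference quotient \<open>g\<close>. On the geodesic between two points of
  scalar part \<open>\<lambda>\<close> the scalar part is therefore \<open>\<lambda>\<^sup>1\<^sup>/\<^sup>2 (\<lambda>\<^sup>-\<^sup>1\<^sup>/\<^sup>2 \<lambda> \<lambda>\<^sup>-\<^sup>1\<^sup>/\<^sup>2)\<^sup>t \<lambda>\<^sup>1\<^sup>/\<^sup>2 = \<lambda>\<close>
  (\<open>geodesic_in_leaf\<close>).

  The operator powers are limits of polynomials, so the algebraic rules for them require
  \<open>\<parallel>P(T)\<parallel> \<le> sup |P|\<close> over the spectrum of a self-adjoint \<open>T\<close> (\<open>norm_poly_op_le\<close>). This is obtained without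
  spectral measures: coercive operators are invertible (\<open>coercive_invertible\<close>), a real polynomial without
  zeros on the spectrum gives an invertible operator (\<open>poly_op_invertible\<close>), and \<open>\<parallel>S\<parallel>\<close> or \<open>- \<parallel>S\<parallel>\<close> lies in
  the spectrum of a self-adjoint \<open>S\<close> (\<open>norm_in_spectrum\<close>).\<close>


section \<open>Self-adjoint and invertible operators\<close>

text \<open>Moving \<open>T\<close> to the other side of the inner product turns complex linearity into sesquilinearity of
  \<open>cinner\<close>. For all operators built below only self-adjointness then has to be tracked.\<close>

lemma selfadjoint_complex_linear:
  assumes "selfadjoint (T :: 'h::complex_hilbert \<Rightarrow>\<^sub>L 'h)"
  shows "complex_linear T"
  unfolding complex_linear_def
proof (intro allI)
  fix c x
  have "cinner (T (c *\<^sub>C x) - c *\<^sub>C T x) y = 0" for y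
    using assms by (simp add: cinner_diff_left cinner_scaleC_left selfadjoint_def)
  then show "T (c *\<^sub>C x) = c *\<^sub>C T x"
    by (metis cinner_self of_real_eq_0_iff power_eq_0_iff norm_eq_zero right_minus_eq)
qed

lemma selfadjoint_inner:
  "selfadjoint (T :: 'h::complex_hilbert \<Rightarrow>\<^sub>L 'h) \<Longrightarrow> inner (T x) y = inner x (T y)"
  by (simp add: selfadjoint_def Re_cinner[symmetric])

lemma selfadjoint_id: "selfadjoint (id_blinfun :: 'h::complex_hilbert \<Rightarrow>\<^sub>L 'h)"
  by (simp add: selfadjoint_def)

lemma selfadjoint_add:
  "selfadjoint S \<Longrightarrow> selfadjoint T \<Longrightarrow> selfadjoint (S + T :: 'h::complex_hilbert \<Rightarrow>\<^sub>L 'h)"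
  by (simp add: selfadjoint_def blinfun.bilinear_simps cinner_add_left cinner_add_right)

lemma selfadjoint_scaleR:
  "selfadjoint T \<Longrightarrow> selfadjoint (r *\<^sub>R T :: 'h::complex_hilbert \<Rightarrow>\<^sub>L 'h)"
  by (simp add: selfadjoint_def blinfun.bilinear_simps cinner_scaleR_left cinner_scaleR_right)

lemma selfadjoint_diff:
  "selfadjoint S \<Longrightarrow> selfadjoint T \<Longrightarrow> selfadjoint (S - T :: 'h::complex_hilbert \<Rightarrow>\<^sub>L 'h)"
  by (simp add: selfadjoint_def blinfun.bilinear_simps cinner_diff_left cinner_diff_right)

lemma selfadjoint_compose:
  assumes "selfadjoint S" "selfadjoint T" "S o\<^sub>L T = T o\<^sub>L (S :: 'h::complex_hilbert \<Rightarrow>\<^sub>L 'h)"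
  shows "selfadjoint (S o\<^sub>L T)"
proof -
  have "S (T x) = T (S x)" for x
    using assms(3) by (metis blinfun_apply_blinfun_compose)
  then show ?thesis
    using assms(1,2) by (simp add: selfadjoint_def)
qed

lemma selfadjoint_sandwich:
  "selfadjoint S \<Longrightarrow> selfadjoint T \<Longrightarrow> selfadjoint (S o\<^sub>L T o\<^sub>L S :: 'h::complex_hilbert \<Rightarrow>\<^sub>L 'h)"
  by (simp add: selfadjoint_def)

lemma selfadjoint_limit:
  fixes T :: "nat \<Rightarrow> 'h::complex_hilbert \<Rightarrow>\<^sub>L 'h"
  assumes "\<And>n. selfadjoint (T n)" "T \<longlonglongrightarrow> A"
  shows "selfadjoint A"
  unfolding selfadjoint_def
proof (intro allI)
  fix x y
  have ax: "(\<lambda>n. T n x) \<longlonglongrightarrow> A x" for x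
    by (intro blinfun.tendsto assms(2) tendsto_const)
  have "(\<lambda>n. cinner (T n x) y) \<longlonglongrightarrow> cinner (A x) y"
    by (rule bounded_linear.tendsto[OF bounded_linear_cinner_left ax])
  moreover have "(\<lambda>n. cinner (T n x) y) \<longlonglongrightarrow> cinner x (A y)"
    using bounded_linear.tendsto[OF bounded_linear_cinner_right ax] assms(1)
    by (simp add: selfadjoint_def)
  ultimately show "cinner (A x) y = cinner x (A y)" by (rule LIMSEQ_unique)
qed

lemma cscale_op_of_real: "cscale_op (complex_of_real r) = r *\<^sub>R (id_blinfun :: 'h::complex_hilbert \<Rightarrow>\<^sub>L 'h)"
  by (rule blinfun_eqI) (simp add: cscale_op_apply blinfun.bilinear_simps scaleR_scaleC)

interpretation blinfun_compose: bounded_bilinear "(o\<^sub>L)"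
  by (rule bounded_bilinear_blinfun_compose)

lemma blinfun_compose_assoc: "(A o\<^sub>L B) o\<^sub>L C = A o\<^sub>L (B o\<^sub>L C)"
  by (rule blinfun_eqI) simp

lemma blinfun_compose_id [simp]: "A o\<^sub>L id_blinfun = A" "id_blinfun o\<^sub>L A = A"
  by (rule blinfun_eqI, simp)+

lemma invertible_op_compose:
  assumes "invertible_op S" "invertible_op (T :: 'h::complex_hilbert \<Rightarrow>\<^sub>L 'h)"
  shows "invertible_op (S o\<^sub>L T)"
proof -
  obtain S' T' where "S' o\<^sub>L S = id_blinfun" "S o\<^sub>L S' = id_blinfun"
    "T' o\<^sub>L T = id_blinfun" "T o\<^sub>L T' = id_blinfun"
    using assms by (auto simp: invertible_op_def)
  then have "(T' o\<^sub>L S') o\<^sub>L (S o\<^sub>L T) = id_blinfun" "(S o\<^sub>L T) o\<^sub>L (T' o\<^sub>L S') = id_blinfun"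
    by (metis blinfun_compose_assoc blinfun_compose_id)+
  then show ?thesis unfolding invertible_op_def by blast
qed

lemma invertible_op_scaleR:
  assumes "invertible_op (T :: 'h::complex_hilbert \<Rightarrow>\<^sub>L 'h)" "r \<noteq> 0"
  shows "invertible_op (r *\<^sub>R T)"
proof -
  obtain S where "S o\<^sub>L T = id_blinfun" "T o\<^sub>L S = id_blinfun"
    using assms by (auto simp: invertible_op_def)
  then have "((1 / r) *\<^sub>R S) o\<^sub>L (r *\<^sub>R T) = id_blinfun" "(r *\<^sub>R T) o\<^sub>L ((1 / r) *\<^sub>R S) = id_blinfun"
    using assms(2) by (simp_all add: blinfun_compose.scaleR_left blinfun_compose.scaleR_right)
  then show ?thesis unfolding invertible_op_def by blast
qed

text \<open>The Lax-Milgram argument: for \<open>\<tau>\<close> small, \<open>1 - \<tau> T\<close> is a strict contraction, because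
  \<open>\<parallel>x - \<tau> T x\<parallel>\<^sup>2 = \<parallel>x\<parallel>\<^sup>2 - 2 \<tau> \<langle>T x, x\<rangle> + \<tau>\<^sup>2 \<parallel>T x\<parallel>\<^sup>2\<close> and the middle term wins. So \<open>T x = y\<close> has a
  solution as the fixed point of \<open>x \<mapsto> x - \<tau> (T x - y)\<close>.\<close>

lemma coercive_invertible:
  fixes T :: "'h::complex_hilbert \<Rightarrow>\<^sub>L 'h"
  assumes m: "m > 0" and co: "\<And>x. m * (norm x)\<^sup>2 \<le> inner (T x) x"
  shows "invertible_op T"
proof -
  have bel: "m * norm x \<le> norm (T x)" for x
  proof (cases "x = 0")
    case False
    have "m * (norm x)\<^sup>2 \<le> norm (T x) * norm x"
      using co[of x] norm_cauchy_schwarz[of "T x" x] by linarith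
    then show ?thesis using False by (simp add: power2_eq_square)
  qed simp
  have inj: "x = y" if "T x = T y" for x y
    using bel[of "x - y"] that m by (simp add: blinfun.bilinear_simps mult_le_0_iff)
  have surj: "\<exists>x. T x = y" for y
  proof -
    \<comment> \<open>adding \<open>m\<close> ensures \<open>m \<le> K\<close>, so that the squared contraction constant \<open>1 - (m / K)\<^sup>2\<close> is nonnegative; \<open>\<tau>\<close> is \<open>m / K\<^sup>2\<close>\<close>
    define K where "K = norm T + m"
    have K: "K > 0" "m \<le> K" using m by (simp_all add: K_def add_nonneg_pos)
    define q where "q = 1 - (m / K)\<^sup>2"
    have q: "0 \<le> q" "q < 1"
      using K m by (auto simp: q_def power_le_one)
    define f where "f = (\<lambda>x. x - (m / K\<^sup>2) *\<^sub>R (T x - y))"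
    have "dist (f u) (f v) \<le> sqrt q * dist u v" for u v
    proof -
      define w where "w = u - v"
      have fw: "f u - f v = w - (m / K\<^sup>2) *\<^sub>R T w"
        by (simp add: f_def w_def blinfun.bilinear_simps algebra_simps)
      have "(norm (T w))\<^sup>2 \<le> (K * norm w)\<^sup>2"
        using norm_blinfun[of T w] m
        by (intro power_mono) (auto simp: K_def distrib_right intro: order_trans)
      then have TK: "(m / K\<^sup>2)\<^sup>2 * (norm (T w))\<^sup>2 \<le> (m / K\<^sup>2)\<^sup>2 * (K * norm w)\<^sup>2"
        by (intro mult_left_mono) simp_all
      have "(norm (f u - f v))\<^sup>2 = (norm w)\<^sup>2 - 2 * (m / K\<^sup>2) * inner (T w) w + (m / K\<^sup>2)\<^sup>2 * (norm (T w))\<^sup>2"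
        unfolding fw power2_norm_eq_inner
        by (simp add: inner_diff_left inner_diff_right inner_commute power2_eq_square)
      also have "\<dots> \<le> (norm w)\<^sup>2 - 2 * (m / K\<^sup>2) * (m * (norm w)\<^sup>2) + (m / K\<^sup>2)\<^sup>2 * (K * norm w)\<^sup>2"
        using TK mult_left_mono[OF co[of w], of "2 * (m / K\<^sup>2)"] m by simp
      also have "\<dots> = q * (norm w)\<^sup>2"
        using K by (simp add: q_def power2_eq_square field_simps)
      finally have "sqrt ((norm (f u - f v))\<^sup>2) \<le> sqrt (q * (norm w)\<^sup>2)"
        by (rule real_sqrt_le_mono)
      then show ?thesis by (simp add: dist_norm w_def real_sqrt_mult)
    qed
    then have "\<exists>!x. f x = x"
      using q by (intro banach_fix_type[of "sqrt q"]) auto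
    then obtain x where "f x = x" by blast
    then have "T x = y" using m K by (simp add: f_def)
    then show ?thesis ..
  qed
  define S where "S = (\<lambda>y. SOME x. T x = y)"
  have TS: "T (S y) = y" for y
    unfolding S_def using surj by (rule someI_ex)
  have ST: "S (T x) = x" for x
    by (rule inj) (rule TS)
  have bl: "bounded_linear S"
  proof (rule bounded_linear_intro[where K="1 / m"])
    show "S (x + y) = S x + S y" for x y
      by (rule inj) (simp add: TS blinfun.bilinear_simps)
    show "S (r *\<^sub>R x) = r *\<^sub>R S x" for r x
      by (rule inj) (simp add: TS blinfun.bilinear_simps)
    show "norm (S x) \<le> norm x * (1 / m)" for x
      using bel[of "S x"] m by (simp add: TS field_simps)
  qed
  have "Blinfun S o\<^sub>L T = id_blinfun" "T o\<^sub>L Blinfun S = id_blinfun"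
    by (rule blinfun_eqI, simp add: bounded_linear_Blinfun_apply[OF bl] ST TS)+
  then show ?thesis unfolding invertible_op_def by blast
qed

text \<open>Positivity of \<open>W\<close> at the vector \<open>x - t W x\<close> gives \<open>t \<parallel>W x\<parallel>\<^sup>2 \<le> \<langle>W x, x\<rangle>\<close> as soon as \<open>t \<parallel>W\<parallel> \<le> 1\<close>,
  and invertibility bounds \<open>\<parallel>W x\<parallel>\<close> from below by a multiple of \<open>\<parallel>x\<parallel>\<close>.\<close>

lemma positive_invertible_coercive:
  fixes W :: "'h::complex_hilbert \<Rightarrow>\<^sub>L 'h"
  assumes sa: "selfadjoint W" and pos: "\<And>x. 0 \<le> inner (W x) x" and inv: "invertible_op W"
  obtains m where "m > 0" "\<And>x. m * (norm x)\<^sup>2 \<le> inner (W x) x"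
proof -
  obtain S where S: "S o\<^sub>L W = id_blinfun"
    using inv by (auto simp: invertible_op_def)
  define t where "t = 1 / (norm W + 1)"
  have nW: "norm W + 1 > 0" "norm S + 1 > 0" by (simp_all add: add_nonneg_pos)
  then have t: "t > 0" "t * norm W \<le> 1" by (simp_all add: t_def)
  have "t / (norm S + 1)\<^sup>2 * (norm x)\<^sup>2 \<le> inner (W x) x" for x
  proof -
    have "S (W x) = x" using S by (metis blinfun_apply_blinfun_compose blinfun_apply_id_blinfun)
    then have "norm x \<le> norm S * norm (W x)" by (metis norm_blinfun)
    also have "\<dots> \<le> (norm S + 1) * norm (W x)" by (intro mult_right_mono) simp_all
    finally have "(norm x)\<^sup>2 \<le> ((norm S + 1) * norm (W x))\<^sup>2" by (intro power_mono) simp_all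
    then have 1: "t / (norm S + 1)\<^sup>2 * (norm x)\<^sup>2 \<le> t * (norm (W x))\<^sup>2"
      using t nW by (simp add: power_mult_distrib pos_divide_le_eq mult_ac)
    have "inner (W (W x)) (W x) \<le> norm (W (W x)) * norm (W x)" by (rule norm_cauchy_schwarz)
    also have "\<dots> \<le> norm W * norm (W x) * norm (W x)"
      by (intro mult_right_mono norm_blinfun) simp
    finally have "t * (t * inner (W (W x)) (W x)) \<le> t * (t * (norm W * (norm (W x))\<^sup>2))"
      using t by (simp add: power2_eq_square mult.assoc)
    also have "\<dots> = t * (norm (W x))\<^sup>2 * (t * norm W)" by (simp add: mult_ac)
    also have "\<dots> \<le> t * (norm (W x))\<^sup>2 * 1"
      using t by (intro mult_left_mono) simp_all
    finally have 2: "t * (t * inner (W (W x)) (W x)) \<le> t * (norm (W x))\<^sup>2" by simp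
    have "inner (W x) (W x) = (norm (W x))\<^sup>2" by (simp add: power2_norm_eq_inner)
    then have "inner (W (x - t *\<^sub>R W x)) (x - t *\<^sub>R W x)
        = inner (W x) x - 2 * (t * (norm (W x))\<^sup>2) + t * (t * inner (W (W x)) (W x))"
      using selfadjoint_inner[OF sa, of "W x" x]
      by (simp add: blinfun.bilinear_simps inner_diff_left inner_diff_right algebra_simps)
    with pos[of "x - t *\<^sub>R W x"] 1 2 show ?thesis by linarith
  qed
  moreover have "t / (norm S + 1)\<^sup>2 > 0" using t nW by simp
  ultimately show ?thesis using that by blast
qed


section \<open>Real polynomials in a self-adjoint operator\<close>

lemma poly_op_altdef: "n \<ge> degree P \<Longrightarrow> poly_op P T = (\<Sum>i\<le>n. coeff P i *\<^sub>R ((o\<^sub>L) T ^^ i) id_blinfun)"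
  unfolding poly_op_def by (rule sum.mono_neutral_left) (auto simp: coeff_eq_0)

lemma poly_op_0 [simp]: "poly_op 0 T = 0"
  by (simp add: poly_op_def)

lemma poly_op_pCons: "poly_op (pCons a P) T = a *\<^sub>R id_blinfun + (T o\<^sub>L poly_op P T)"
proof -
  have "poly_op (pCons a P) T = (\<Sum>i\<le>Suc (degree P). coeff (pCons a P) i *\<^sub>R ((o\<^sub>L) T ^^ i) id_blinfun)"
    by (rule poly_op_altdef) (simp add: degree_pCons_le)
  also have "\<dots> = a *\<^sub>R id_blinfun + (\<Sum>i\<le>degree P. coeff P i *\<^sub>R (T o\<^sub>L ((o\<^sub>L) T ^^ i) id_blinfun))"
    by (subst sum.atMost_Suc_shift) simp
  also have "\<dots> = a *\<^sub>R id_blinfun + (T o\<^sub>L poly_op P T)"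
    by (simp add: poly_op_def blinfun_compose.sum_right blinfun_compose.scaleR_right)
  finally show ?thesis .
qed

lemma poly_op_add: "poly_op (P + Q) T = poly_op P T + poly_op Q T"
  by (induction P Q rule: poly_induct2)
    (simp_all add: poly_op_pCons blinfun_compose.add_right scaleR_add_left)

lemma poly_op_smult: "poly_op (smult r P) T = r *\<^sub>R poly_op P T"
  by (induction P) (simp_all add: poly_op_pCons blinfun_compose.scaleR_right scaleR_add_right)

lemma poly_op_diff: "poly_op (P - Q) T = poly_op P T - poly_op Q T"
  using poly_op_add[of "P - Q" Q T] by simp

lemma poly_op_mult: "poly_op (P * Q) T = poly_op P T o\<^sub>L poly_op Q T"
  by (induction P) (simp_all add: poly_op_pCons poly_op_add poly_op_smult blinfun_compose.add_left
      blinfun_compose.scaleR_left blinfun_compose.zero_left blinfun_compose_assoc)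

lemma poly_op_commute: "poly_op P T o\<^sub>L poly_op Q T = poly_op Q T o\<^sub>L poly_op P T"
  by (metis poly_op_mult mult.commute)

lemma poly_op_const: "poly_op [:r:] T = r *\<^sub>R id_blinfun"
  by (simp add: poly_op_pCons)

lemma poly_op_linear: "poly_op [:a, b:] T = a *\<^sub>R id_blinfun + b *\<^sub>R T"
  by (simp add: poly_op_pCons blinfun_compose.add_right blinfun_compose.scaleR_right)

lemma selfadjoint_poly_op:
  assumes "selfadjoint T"
  shows "selfadjoint (poly_op P T)"
proof (induction P)
  case 0
  then show ?case by (simp add: selfadjoint_def)
next
  case (pCons a P)
  have "T o\<^sub>L poly_op P T = poly_op P T o\<^sub>L T"
    using poly_op_commute[of "[:0, 1:]" T P] by (simp add: poly_op_linear)
  then show ?case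
    unfolding poly_op_pCons
    by (intro selfadjoint_add selfadjoint_scaleR selfadjoint_id selfadjoint_compose assms pCons)
qed

text \<open>Take a complex root \<open>a + i b\<close>. If \<open>b \<noteq> 0\<close>, the remainder of \<open>P\<close> modulo the quadratic with roots
  \<open>a \<plusminus> i b\<close> is a real polynomial of degree at most one that vanishes at a non-real point, hence is zero.\<close>

lemma real_poly_irreducible_factor:
  fixes P :: "real poly"
  assumes "degree P > 0"
  obtains r where "poly P r = 0" | a b where "b \<noteq> 0" "[:a\<^sup>2 + b\<^sup>2, - 2 * a, 1:] dvd P"
proof -
  \<comment> \<open>evaluation of a real polynomial at a complex point, as a ring homomorphism\<close>
  define ev where "ev = (\<lambda>Q z. poly (map_poly complex_of_real Q) z)"
  have ev_pCons: "ev (pCons a Q) z = of_real a + z * ev Q z" for a Q z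
    by (simp add: ev_def map_poly_pCons)
  have ev0: "ev 0 z = 0" for z by (simp add: ev_def)
  have ev_add: "ev (Q + R) z = ev Q z + ev R z" for Q R z
    by (induction Q R rule: poly_induct2) (simp_all add: ev0 ev_pCons algebra_simps)
  have ev_smult: "ev (smult r Q) z = of_real r * ev Q z" for r Q z
    by (induction Q) (simp_all add: ev0 ev_pCons algebra_simps)
  have ev_mult: "ev (Q * R) z = ev Q z * ev R z" for Q R z
    by (induction Q) (simp_all add: ev0 ev_pCons ev_add ev_smult algebra_simps)
  have "degree (map_poly complex_of_real P) = degree P"
    by (rule degree_map_poly) simp
  then have "\<not> constant (poly (map_poly complex_of_real P))"
    using assms by (simp add: constant_degree)
  then obtain z where z: "ev P z = 0"
    unfolding ev_def using fundamental_theorem_of_algebra by blast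
  define a b where "a = Re z" and "b = Im z"
  have zab: "z = Complex a b" by (simp add: a_def b_def)
  show ?thesis
  proof (cases "b = 0")
    case True
    then have "z = of_real a" by (simp add: complex_eq_iff zab)
    moreover have "ev Q (of_real a) = of_real (poly Q a)" for Q
      by (induction Q) (simp_all add: ev0 ev_pCons)
    ultimately have "poly P a = 0" using z by simp
    then show ?thesis by (rule that(1))
  next
    case False
    define q where "q = [:a\<^sup>2 + b\<^sup>2, - 2 * a, 1:]"
    have "ev q z = 0"
      by (simp add: q_def ev_pCons ev0 zab complex_eq_iff power2_eq_square algebra_simps)
    moreover have "P = P div q * q + P mod q" by simp
    ultimately have evm: "ev (P mod q) z = 0"
      using z by (metis ev_add ev_mult mult_zero_right add_0)
    have "q \<noteq> 0" "degree q = 2" by (simp_all add: q_def)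
    then have "degree (P mod q) \<le> 1"
      using degree_mod_less[of q P] by auto
    then obtain u v where uv: "P mod q = [:u, v:]"
      by (metis degree_eq_zeroE degree1_coeffs le_eq_less_or_eq less_one pCons_0_0)
    have "v = 0" "u = 0"
      using evm False by (auto simp: uv ev_pCons ev0 zab complex_eq_iff)
    then have "q dvd P" using uv by (simp add: mod_eq_0_iff_dvd)
    then show ?thesis using that(2) False by (simp add: q_def)
  qed
qed

text \<open>One half of the spectral mapping theorem, by splitting off irreducible real factors. A linear factor
  \<open>X - r\<close> of \<open>P\<close> has \<open>r\<close> outside the spectrum, so \<open>T - r\<close> is invertible; a quadratic factor
  \<open>(X - a)\<^sup>2 + b\<^sup>2\<close> gives an operator bounded below by \<open>b\<^sup>2 > 0\<close>, whatever the spectrum is.\<close>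

lemma poly_op_invertible:
  fixes T :: "'h::complex_hilbert \<Rightarrow>\<^sub>L 'h"
  assumes T: "selfadjoint T"
  shows "P \<noteq> 0 \<Longrightarrow> (\<And>r. complex_of_real r \<in> op_spectrum T \<Longrightarrow> poly P r \<noteq> 0) \<Longrightarrow> invertible_op (poly_op P T)"
proof (induction "degree P" arbitrary: P rule: less_induct)
  case less
  show ?case
  proof (cases "degree P = 0")
    case True
    then obtain r where r: "P = [:r:]" by (metis degree_eq_zeroE)
    have "invertible_op (id_blinfun :: 'h \<Rightarrow>\<^sub>L 'h)"
      unfolding invertible_op_def by (rule exI[of _ id_blinfun]) simp
    then show ?thesis
      using less.prems(1) by (simp add: r poly_op_const invertible_op_scaleR)
  next
    case False
    have step: "invertible_op (poly_op P T)"
      if q: "q dvd P" "degree q > 0" and inv: "invertible_op (poly_op q T)" for q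
    proof -
      obtain Q where Q: "P = q * Q" using q by (elim dvdE)
      then have "Q \<noteq> 0" "q \<noteq> 0" using less.prems(1) by auto
      then have "degree Q < degree P" using q Q by (simp add: degree_mult_eq)
      then have "invertible_op (poly_op Q T)"
        using less.prems \<open>Q \<noteq> 0\<close> by (intro less.hyps) (auto simp: Q)
      then show ?thesis
        unfolding Q poly_op_mult by (rule invertible_op_compose[OF inv])
    qed
    from False have "degree P > 0" by simp
    then show ?thesis
    proof (cases rule: real_poly_irreducible_factor)
      case (1 r)
      have "complex_of_real r \<notin> op_spectrum T" using less.prems(2) 1 by blast
      then have "invertible_op (poly_op [:- r, 1:] T)"
        by (simp add: op_spectrum_def cscale_op_of_real poly_op_linear)
      with 1 show ?thesis by (intro step[of "[:- r, 1:]"]) (simp_all add: poly_eq_0_iff_dvd)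
    next
      case (2 a b)
      define D where "D = T - a *\<^sub>R id_blinfun"
      have sa: "selfadjoint D"
        unfolding D_def by (intro selfadjoint_diff selfadjoint_scaleR selfadjoint_id T)
      have "poly_op [:a\<^sup>2 + b\<^sup>2, - 2 * a, 1:] T x = D (D x) + b\<^sup>2 *\<^sub>R x" for x
        by (simp add: D_def poly_op_pCons blinfun.bilinear_simps power2_eq_square algebra_simps)
          (simp only: mult_2_right scaleR_add_left)
      then have "inner (poly_op [:a\<^sup>2 + b\<^sup>2, - 2 * a, 1:] T x) x = (norm (D x))\<^sup>2 + b\<^sup>2 * (norm x)\<^sup>2" for x
        using selfadjoint_inner[OF sa, of "D x" x] by (simp add: inner_add_left power2_norm_eq_inner)
      then have "invertible_op (poly_op [:a\<^sup>2 + b\<^sup>2, - 2 * a, 1:] T)"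
        using 2 by (intro coercive_invertible[of "b\<^sup>2"]) simp_all
      with 2 show ?thesis by (intro step[of "[:a\<^sup>2 + b\<^sup>2, - 2 * a, 1:]"]) simp_all
    qed
  qed
qed

text \<open>If both \<open>S - \<parallel>S\<parallel>\<close> and \<open>S + \<parallel>S\<parallel>\<close> were invertible, then so would be the positive operator \<open>\<parallel>S\<parallel>\<^sup>2 - S\<^sup>2\<close>.
  It would be coercive, and \<open>\<parallel>S x\<parallel>\<^sup>2 \<le> (\<parallel>S\<parallel>\<^sup>2 - m) \<parallel>x\<parallel>\<^sup>2\<close> would contradict the definition of the operator norm.
  The vector \<open>x\<close> excludes the zero space, where every operator is invertible.\<close>

lemma norm_in_spectrum:
  fixes S :: "'h::complex_hilbert \<Rightarrow>\<^sub>L 'h" and x :: 'h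
  assumes S: "selfadjoint S" and x: "x \<noteq> 0"
  shows "complex_of_real (norm S) \<in> op_spectrum S \<or> complex_of_real (- norm S) \<in> op_spectrum S"
proof (rule ccontr)
  define N where "N = norm S"
  assume "\<not> ?thesis"
  then have "invertible_op (S - N *\<^sub>R id_blinfun)" "invertible_op (S - (- N) *\<^sub>R id_blinfun)"
    unfolding op_spectrum_def N_def cscale_op_of_real[symmetric] by simp_all
  then have "invertible_op ((- 1) *\<^sub>R ((S - N *\<^sub>R id_blinfun) o\<^sub>L (S - (- N) *\<^sub>R id_blinfun)))"
    by (intro invertible_op_scaleR invertible_op_compose) simp_all
  moreover define W where "W = N\<^sup>2 *\<^sub>R id_blinfun - (S o\<^sub>L S)"
  moreover have "(- 1) *\<^sub>R ((S - N *\<^sub>R id_blinfun) o\<^sub>L (S - (- N) *\<^sub>R id_blinfun)) = W"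
    by (rule blinfun_eqI) (simp add: W_def blinfun.bilinear_simps power2_eq_square algebra_simps)
  ultimately have inv: "invertible_op W" by simp
  have sa: "selfadjoint W"
    unfolding W_def by (intro selfadjoint_diff selfadjoint_scaleR selfadjoint_id selfadjoint_compose S refl)
  have W: "inner (W y) y = N\<^sup>2 * (norm y)\<^sup>2 - (norm (S y))\<^sup>2" for y
    by (simp add: W_def blinfun.bilinear_simps inner_diff_left selfadjoint_inner[OF S] power2_norm_eq_inner)
  have pos: "0 \<le> inner (W y) y" for y
    using power_mono[OF norm_blinfun[of S y], of 2] by (simp add: W N_def power_mult_distrib)
  obtain m where m: "m > 0" "\<And>y. m * (norm y)\<^sup>2 \<le> inner (W y) y"
    using positive_invertible_coercive[OF sa pos inv] by blast
  have le: "(norm (S y))\<^sup>2 \<le> (N\<^sup>2 - m) * (norm y)\<^sup>2" for y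
    using m(2)[of y] by (simp add: W algebra_simps)
  have "0 \<le> (N\<^sup>2 - m) * (norm x)\<^sup>2"
    using le[of x] zero_le_power2[of "norm (S x)"] by linarith
  then have Nm: "0 \<le> N\<^sup>2 - m" using x by (simp add: zero_le_mult_iff)
  have "N \<le> sqrt (N\<^sup>2 - m)"
    unfolding N_def
  proof (rule norm_blinfun_bound)
    show "norm (S y) \<le> sqrt ((norm S)\<^sup>2 - m) * norm y" for y
      using real_sqrt_le_mono[OF le[of y]] by (simp add: real_sqrt_mult N_def)
  qed (use Nm N_def in simp)
  then have "N\<^sup>2 \<le> (sqrt (N\<^sup>2 - m))\<^sup>2"
    by (intro power_mono) (simp_all add: N_def)
  then show False using Nm m(1) by simp
qed

text \<open>The estimate that makes the functional calculus converge: were \<open>N = \<parallel>P(T)\<parallel>\<close> larger than \<open>M\<close>,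
  neither \<open>P - N\<close> nor \<open>P + N\<close> would vanish on the spectrum of \<open>T\<close>, so \<open>P(T) \<plusminus> N\<close> would both be invertible.\<close>

lemma norm_poly_op_le:
  fixes T :: "'h::complex_hilbert \<Rightarrow>\<^sub>L 'h"
  assumes T: "selfadjoint T" and M: "M \<ge> 0"
    and le: "\<And>r. complex_of_real r \<in> op_spectrum T \<Longrightarrow> \<bar>poly P r\<bar> \<le> M"
  shows "norm (poly_op P T) \<le> M"
proof (rule ccontr)
  assume large: "\<not> ?thesis"
  define N where "N = norm (poly_op P T)"
  have N: "N > M" using large by (simp add: N_def)
  then have "poly_op P T \<noteq> 0" using M by (auto simp: N_def)
  then obtain x :: 'h where x: "x \<noteq> 0"
    by (metis blinfun_eqI blinfun.zero_right zero_blinfun.rep_eq)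
  have inv: "invertible_op (poly_op P T - cscale_op (complex_of_real s))" if s: "\<bar>s\<bar> = N" for s
  proof -
    have ne: "poly (P - [:s:]) r \<noteq> 0" if "complex_of_real r \<in> op_spectrum T" for r
      using le[OF that] s N by auto
    \<comment> \<open>here the spectrum of \<open>T\<close> must be nonempty, which the previous lemma for \<open>T\<close> itself provides\<close>
    moreover have "P - [:s:] \<noteq> 0"
      using norm_in_spectrum[OF T x] ne by (metis poly_0)
    ultimately have "invertible_op (poly_op (P - [:s:]) T)"
      by (intro poly_op_invertible[OF T])
    then show ?thesis by (simp add: poly_op_diff poly_op_const cscale_op_of_real)
  qed
  show False
    using norm_in_spectrum[OF selfadjoint_poly_op[OF T] x, of P] inv[of N] inv[of "- N"] N M
    unfolding op_spectrum_def N_def[symmetric] by simp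
qed


section \<open>The continuous functional calculus\<close>

text \<open>By the norm estimate, \<open>P\<^sub>n(T)\<close> is a Cauchy sequence, and two sequences of polynomials with the same
  uniform limit on the spectrum give the same operator limit. The given sequence \<open>P\<close> also ensures that the
  description of \<open>fun_calc f T\<close> is not satisfied vacuously.\<close>

lemma fun_calc_limit:
  fixes T :: "'h::complex_hilbert \<Rightarrow>\<^sub>L 'h"
  assumes T: "selfadjoint T"
    and P: "uniform_limit {r. complex_of_real r \<in> op_spectrum T} (\<lambda>n. poly (P n)) f sequentially"
  shows "(\<lambda>n. poly_op (P n) T) \<longlonglongrightarrow> fun_calc f T"
proof -
  let ?\<sigma> = "{r. complex_of_real r \<in> op_spectrum T}"
  have close: "\<exists>N. \<forall>n\<ge>N. \<forall>m\<ge>N. norm (poly_op (P n) T - poly_op (Q m) T) < \<epsilon>"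
    if P: "uniform_limit ?\<sigma> (\<lambda>n. poly (P n)) f sequentially"
      and Q: "uniform_limit ?\<sigma> (\<lambda>n. poly (Q n)) f sequentially" and \<epsilon>: "\<epsilon> > 0" for P Q :: "nat \<Rightarrow> real poly" and \<epsilon>
  proof -
    obtain N1 where N1: "\<And>n r. n \<ge> N1 \<Longrightarrow> r \<in> ?\<sigma> \<Longrightarrow> dist (poly (P n) r) (f r) < \<epsilon> / 4"
      using uniform_limitD[OF P, of "\<epsilon> / 4"] \<epsilon> unfolding eventually_sequentially by auto
    obtain N2 where N2: "\<And>n r. n \<ge> N2 \<Longrightarrow> r \<in> ?\<sigma> \<Longrightarrow> dist (poly (Q n) r) (f r) < \<epsilon> / 4"
      using uniform_limitD[OF Q, of "\<epsilon> / 4"] \<epsilon> unfolding eventually_sequentially by auto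
    have "norm (poly_op (P n) T - poly_op (Q m) T) < \<epsilon>" if "n \<ge> max N1 N2" "m \<ge> max N1 N2" for n m
    proof -
      have "norm (poly_op (P n - Q m) T) \<le> \<epsilon> / 2"
      proof (rule norm_poly_op_le[OF T])
        fix r assume "complex_of_real r \<in> op_spectrum T"
        then have "dist (poly (P n) r) (f r) < \<epsilon> / 4" "dist (poly (Q m) r) (f r) < \<epsilon> / 4"
          using N1 N2 that by simp_all
        then have "dist (poly (P n) r) (poly (Q m) r) \<le> \<epsilon> / 2"
          using dist_triangle2[of "poly (P n) r" "poly (Q m) r" "f r"] by linarith
        then show "\<bar>poly (P n - Q m) r\<bar> \<le> \<epsilon> / 2"
          by (simp only: dist_real_def poly_diff)
      qed (use \<epsilon> in simp)
      then show ?thesis using \<epsilon> by (simp add: poly_op_diff)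
    qed
    then show ?thesis by blast
  qed
  have "Cauchy (\<lambda>n. poly_op (P n) T)"
    using close[OF P P] by (intro CauchyI) blast
  then obtain A where A: "(\<lambda>n. poly_op (P n) T) \<longlonglongrightarrow> A"
    using Cauchy_convergent convergent_def by blast
  have QA: "(\<lambda>n. poly_op (Q n) T) \<longlonglongrightarrow> A"
    if Q: "uniform_limit ?\<sigma> (\<lambda>n. poly (Q n)) f sequentially" for Q
  proof (rule Lim_transform[OF A])
    show "(\<lambda>n. poly_op (Q n) T - poly_op (P n) T) \<longlonglongrightarrow> 0"
    proof (rule LIMSEQ_I)
      fix \<epsilon> :: real assume "\<epsilon> > 0"
      from close[OF Q P this] show "\<exists>N. \<forall>n\<ge>N. norm (poly_op (Q n) T - poly_op (P n) T - 0) < \<epsilon>"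
        by auto
    qed
  qed
  have "fun_calc f T = A"
    unfolding fun_calc_def
  proof (rule the_equality)
    show "\<forall>Q. uniform_limit ?\<sigma> (\<lambda>n. poly (Q n)) f sequentially \<longrightarrow> (\<lambda>n. poly_op (Q n) T) \<longlonglongrightarrow> A"
      using QA by (intro allI impI)
    show "B = A" if "\<forall>Q. uniform_limit ?\<sigma> (\<lambda>n. poly (Q n)) f sequentially \<longrightarrow> (\<lambda>n. poly_op (Q n) T) \<longlonglongrightarrow> B" for B
      using that[rule_format, OF P] A by (rule LIMSEQ_unique)
  qed
  then show ?thesis using A by simp
qed

lemma weierstrass_poly:
  fixes f :: "real \<Rightarrow> real"
  assumes f: "continuous_on {c..C} f"
  obtains P where "uniform_limit {c..C} (\<lambda>n. poly (P n)) f sequentially"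
proof -
  have "\<exists>p. \<forall>x\<in>{c..C}. \<bar>f x - poly p x\<bar> < \<epsilon>" if \<epsilon>: "\<epsilon> > 0" for \<epsilon>
  proof -
    obtain g where g: "real_polynomial_function g" "\<And>x. x \<in> {c..C} \<Longrightarrow> \<bar>f x - g x\<bar> < \<epsilon>"
      using Stone_Weierstrass_real_polynomial_function[OF compact_Icc f \<epsilon>] by blast
    obtain a n where "g = (\<lambda>x. \<Sum>i\<le>n. a i * x ^ i)"
      using g(1) by (auto simp: real_polynomial_function_iff_sum)
    then have "poly (\<Sum>i\<le>n. monom (a i) i) x = g x" for x
      by (simp add: poly_sum poly_monom)
    then show ?thesis
      using g(2) by (intro exI[of _ "\<Sum>i\<le>n. monom (a i) i"]) simp
  qed
  then have "\<forall>n. \<exists>p. \<forall>x\<in>{c..C}. \<bar>f x - poly p x\<bar> < inverse (real (Suc n))"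
    by simp
  then obtain P where P: "\<And>n x. x \<in> {c..C} \<Longrightarrow> \<bar>f x - poly (P n) x\<bar> < inverse (real (Suc n))"
    unfolding choice_iff by blast
  have "uniform_limit {c..C} (\<lambda>n. poly (P n)) f sequentially"
  proof (rule uniform_limitI)
    fix \<epsilon> :: real assume "\<epsilon> > 0"
    then obtain N where N: "inverse (real (Suc N)) < \<epsilon>"
      using reals_Archimedean by blast
    have "dist (poly (P n) x) (f x) < \<epsilon>" if "n \<ge> N" "x \<in> {c..C}" for n x
    proof -
      have "inverse (real (Suc n)) \<le> inverse (real (Suc N))" using that by simp
      then show ?thesis
        using P[OF that(2), of n] N unfolding dist_real_def abs_minus_commute[of "f x"] by linarith
    qed
    then show "\<forall>\<^sub>F n in sequentially. \<forall>x\<in>{c..C}. dist (poly (P n) x) (f x) < \<epsilon>"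
      unfolding eventually_sequentially by blast
  qed
  then show ?thesis by (rule that)
qed

text \<open>The operator inequality \<open>c \<le> T \<le> C\<close>. It puts the real spectrum into the compact interval \<open>[c, C]\<close>, where
  the Weierstrass theorem applies; all approximations below are made there.\<close>

definition form_between :: "real \<Rightarrow> real \<Rightarrow> ('h::complex_hilbert \<Rightarrow>\<^sub>L 'h) \<Rightarrow> bool" where
  "form_between c C T \<longleftrightarrow> selfadjoint T \<and>
     (\<forall>x. c * (norm x)\<^sup>2 \<le> inner (T x) x \<and> inner (T x) x \<le> C * (norm x)\<^sup>2)"

lemma spectrum_between:
  assumes T: "form_between c C T" and r: "complex_of_real r \<in> op_spectrum T"
  shows "r \<in> {c..C}"
proof (rule ccontr)
  have shift: "inner ((T - r *\<^sub>R id_blinfun) x) x = inner (T x) x - r * (norm x)\<^sup>2" for x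
    by (simp add: blinfun.diff_left blinfun.scaleR_left inner_diff_left power2_norm_eq_inner)
  have bounds: "c * (norm x)\<^sup>2 \<le> inner (T x) x" "inner (T x) x \<le> C * (norm x)\<^sup>2" for x
    using T by (simp_all add: form_between_def)
  assume "r \<notin> {c..C}"
  then consider "r < c" | "C < r" by auto
  then have "invertible_op (T - r *\<^sub>R id_blinfun)"
  proof cases
    case 1
    have "(c - r) * (norm x)\<^sup>2 \<le> inner ((T - r *\<^sub>R id_blinfun) x) x" for x
      using bounds(1)[of x] unfolding shift left_diff_distrib by simp
    then show ?thesis using 1 by (intro coercive_invertible[of "c - r"]) simp_all
  next
    case 2
    have "(r - C) * (norm x)\<^sup>2 \<le> inner (((- 1) *\<^sub>R (T - r *\<^sub>R id_blinfun)) x) x" for x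
      using bounds(2)[of x] shift[of x] unfolding left_diff_distrib scaleR_blinfun.rep_eq inner_scaleR_left
      by linarith
    then have "invertible_op ((- 1) *\<^sub>R (T - r *\<^sub>R id_blinfun))"
      using 2 by (intro coercive_invertible[of "r - C"]) simp_all
    from invertible_op_scaleR[OF this, of "-1"] show ?thesis by simp
  qed
  then show False
    using r by (simp add: op_spectrum_def cscale_op_of_real)
qed

text \<open>Combined with the Weierstrass theorem, this transfers identities between polynomials to continuous
  functions on \<open>[c, C]\<close>; the next lemmas are instances.\<close>

lemma fun_calc_limit_between:
  assumes T: "form_between c C T"
    and P: "uniform_limit {c..C} (\<lambda>n. poly (P n)) f sequentially"
  shows "(\<lambda>n. poly_op (P n) T) \<longlonglongrightarrow> fun_calc f T"
proof (rule fun_calc_limit)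
  show "selfadjoint T" using T by (simp add: form_between_def)
  show "uniform_limit {r. complex_of_real r \<in> op_spectrum T} (\<lambda>n. poly (P n)) f sequentially"
    by (rule uniform_limit_on_subset[OF P]) (use spectrum_between[OF T] in blast)
qed

lemma selfadjoint_fun_calc:
  assumes T: "form_between c C T" and f: "continuous_on {c..C} f"
  shows "selfadjoint (fun_calc f T)"
proof -
  obtain P where "uniform_limit {c..C} (\<lambda>n. poly (P n)) f sequentially"
    using weierstrass_poly[OF f] .
  then have lim: "(\<lambda>n. poly_op (P n) T) \<longlonglongrightarrow> fun_calc f T"
    by (rule fun_calc_limit_between[OF T])
  have "selfadjoint T" using T by (simp add: form_between_def)
  then have "selfadjoint (poly_op (P n) T)" for n by (rule selfadjoint_poly_op)
  then show ?thesis using lim by (rule selfadjoint_limit)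
qed

lemma fun_calc_poly:
  assumes T: "form_between c C T" and f: "\<And>x. x \<in> {c..C} \<Longrightarrow> f x = poly p x"
  shows "fun_calc f T = poly_op p T"
proof -
  have "uniform_limit {c..C} (\<lambda>n. poly p) f sequentially"
    by (rule uniform_limitI) (simp add: f)
  from fun_calc_limit_between[OF T this] show ?thesis
    by (simp add: LIMSEQ_const_iff)
qed

lemma fun_calc_mult:
  assumes T: "form_between c C T" and f: "continuous_on {c..C} f" and g: "continuous_on {c..C} g"
    and h: "\<And>x. x \<in> {c..C} \<Longrightarrow> h x = f x * g x"
  shows "fun_calc h T = fun_calc f T o\<^sub>L fun_calc g T"
proof -
  obtain P where P: "uniform_limit {c..C} (\<lambda>n. poly (P n)) f sequentially"
    using weierstrass_poly[OF f] .
  obtain Q where Q: "uniform_limit {c..C} (\<lambda>n. poly (Q n)) g sequentially"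
    using weierstrass_poly[OF g] .
  have "uniform_limit {c..C} (\<lambda>n x. poly (P n) x * poly (Q n) x) (\<lambda>x. f x * g x) sequentially"
    by (intro uniform_lim_mult P Q compact_imp_bounded compact_continuous_image f g compact_Icc)
  then have "uniform_limit {c..C} (\<lambda>n. poly (P n * Q n)) h sequentially"
    by (rule uniform_limit_cong'[THEN iffD1, rotated 2]) (simp_all add: h)
  from fun_calc_limit_between[OF T this]
  have "(\<lambda>n. poly_op (P n) T o\<^sub>L poly_op (Q n) T) \<longlonglongrightarrow> fun_calc h T"
    by (simp add: poly_op_mult)
  moreover have "(\<lambda>n. poly_op (P n) T o\<^sub>L poly_op (Q n) T) \<longlonglongrightarrow> (fun_calc f T o\<^sub>L fun_calc g T)"
    by (intro blinfun_compose.tendsto fun_calc_limit_between[OF T] P Q)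
  ultimately show ?thesis by (rule LIMSEQ_unique)
qed

lemma fun_calc_add_const:
  assumes T: "form_between c C T" and f: "continuous_on {c..C} f"
    and h: "\<And>x. x \<in> {c..C} \<Longrightarrow> h x = f x + r"
  shows "fun_calc h T = fun_calc f T + r *\<^sub>R id_blinfun"
proof -
  obtain P where P: "uniform_limit {c..C} (\<lambda>n. poly (P n)) f sequentially"
    using weierstrass_poly[OF f] .
  have "uniform_limit {c..C} (\<lambda>n x. poly (P n) x + r) (\<lambda>x. f x + r) sequentially"
    by (intro uniform_limit_intros P)
  then have "uniform_limit {c..C} (\<lambda>n. poly (P n + [:r:])) h sequentially"
    by (rule uniform_limit_cong'[THEN iffD1, rotated 2]) (simp_all add: h)
  from fun_calc_limit_between[OF T this]
  have "(\<lambda>n. poly_op (P n) T + r *\<^sub>R id_blinfun) \<longlonglongrightarrow> fun_calc h T"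
    by (simp add: poly_op_add poly_op_const)
  moreover have "(\<lambda>n. poly_op (P n) T + r *\<^sub>R id_blinfun) \<longlonglongrightarrow> fun_calc f T + r *\<^sub>R id_blinfun"
    by (intro tendsto_intros fun_calc_limit_between[OF T] P)
  ultimately show ?thesis by (rule LIMSEQ_unique)
qed


section \<open>Hilbert-Schmidt perturbations of scalars\<close>

lemma HS_add:
  fixes a b :: "'h::complex_hilbert \<Rightarrow>\<^sub>L 'h"
  assumes a: "a \<in> HS" and b: "b \<in> HS"
  shows "a + b \<in> HS"
proof -
  have "(\<lambda>e. (norm (a e + b e))\<^sup>2) summable_on some_onb"
  proof (rule summable_on_comparison_test)
    show "(\<lambda>e. 2 * ((norm (a e))\<^sup>2 + (norm (b e))\<^sup>2)) summable_on some_onb"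
      using a b by (intro summable_on_cmult_right summable_on_add) (simp_all add: HS_def)
    fix e
    have "(norm (a e + b e))\<^sup>2 \<le> (norm (a e) + norm (b e))\<^sup>2"
      by (intro power_mono norm_triangle_ineq) simp
    also have "\<dots> \<le> 2 * ((norm (a e))\<^sup>2 + (norm (b e))\<^sup>2)"
      using sum_squares_bound[of "norm (a e)" "norm (b e)"] by (simp add: power2_sum)
    finally show "(norm (a e + b e))\<^sup>2 \<le> 2 * ((norm (a e))\<^sup>2 + (norm (b e))\<^sup>2)" .
  qed simp
  then show ?thesis
    using a b by (simp add: HS_def complex_linear_def blinfun.bilinear_simps scaleC_add_right)
qed

lemma HS_compose_left:
  fixes S a :: "'h::complex_hilbert \<Rightarrow>\<^sub>L 'h"
  assumes S: "complex_linear S" and a: "a \<in> HS"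
  shows "S o\<^sub>L a \<in> HS"
proof -
  have "(\<lambda>e. (norm (S (a e)))\<^sup>2) summable_on some_onb"
  proof (rule summable_on_comparison_test)
    show "(\<lambda>e. (norm S)\<^sup>2 * (norm (a e))\<^sup>2) summable_on some_onb"
      using a by (intro summable_on_cmult_right) (simp add: HS_def)
    show "(norm (S (a e)))\<^sup>2 \<le> (norm S)\<^sup>2 * (norm (a e))\<^sup>2" for e
      unfolding power_mult_distrib[symmetric] by (intro power_mono norm_blinfun) simp
  qed simp
  then show ?thesis using S a by (simp add: HS_def complex_linear_def)
qed

lemma selfadjoint_HSh_shift:
  assumes "T - m *\<^sub>R id_blinfun \<in> HSh"
  shows "selfadjoint T"
proof -
  have "selfadjoint ((T - m *\<^sub>R id_blinfun) + m *\<^sub>R id_blinfun)"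
    using assms by (intro selfadjoint_add selfadjoint_scaleR selfadjoint_id) (simp add: HSh_def)
  then show ?thesis by simp
qed

text \<open>Hilbert-Schmidt operators form a left ideal, and \<open>R T R - n m n\<close> is a sum of products whose rightmost
  factor is \<open>R - n\<close> or \<open>T - m\<close>. These products need not be self-adjoint, so the argument runs in \<open>HS\<close>, and
  self-adjointness is recovered from the symmetric shape of \<open>R T R\<close>.\<close>

lemma HSh_sandwich:
  fixes R T :: "'h::complex_hilbert \<Rightarrow>\<^sub>L 'h"
  assumes R: "R - n *\<^sub>R id_blinfun \<in> HSh" and T: "T - m *\<^sub>R id_blinfun \<in> HSh"
  shows "(R o\<^sub>L T o\<^sub>L R) - (n * m * n) *\<^sub>R id_blinfun \<in> HSh"
proof -
  define b where "b = R - n *\<^sub>R id_blinfun"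
  define a where "a = T - m *\<^sub>R id_blinfun"
  have sa: "selfadjoint R" "selfadjoint T"
    using selfadjoint_HSh_shift R T by blast+
  have cl: "complex_linear R" "complex_linear (R o\<^sub>L T)" "complex_linear (r *\<^sub>R id_blinfun :: 'h \<Rightarrow>\<^sub>L 'h)" for r
    using sa[THEN selfadjoint_complex_linear] selfadjoint_complex_linear[OF selfadjoint_scaleR[OF selfadjoint_id]]
    by (simp_all add: complex_linear_def)
  have HS: "a \<in> HS" "b \<in> HS" using R T by (simp_all add: a_def b_def HSh_def)
  have "(R o\<^sub>L T o\<^sub>L R) - (n * m * n) *\<^sub>R id_blinfun
      = ((R o\<^sub>L T) o\<^sub>L b) + ((n *\<^sub>R id_blinfun o\<^sub>L (R o\<^sub>L a)) + ((m * n) *\<^sub>R id_blinfun o\<^sub>L b))"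
    by (rule blinfun_eqI) (simp add: a_def b_def blinfun.bilinear_simps algebra_simps)
  also have "\<dots> \<in> HS"
    by (intro HS_add HS_compose_left cl HS)
  finally have "(R o\<^sub>L T o\<^sub>L R) - (n * m * n) *\<^sub>R id_blinfun \<in> HS" .
  moreover have "selfadjoint ((R o\<^sub>L T o\<^sub>L R) - (n * m * n) *\<^sub>R id_blinfun)"
    by (intro selfadjoint_diff selfadjoint_sandwich sa selfadjoint_scaleR selfadjoint_id)
  ultimately show ?thesis by (simp add: HSh_def)
qed

text \<open>The difference quotient \<open>g\<close> of \<open>f\<close> at \<open>m\<close> extends continuously to \<open>m\<close> by the derivative, and
  \<open>f(x) = f(m) + g(x) (x - m)\<close> becomes \<open>f(T) - f(m) = g(T) (T - m)\<close>, a bounded operator times a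
  Hilbert-Schmidt one. So \<open>f\<close> maps the operators with scalar part \<open>m\<close> to operators with scalar part \<open>f(m)\<close>.\<close>

lemma fun_calc_HSh:
  fixes T :: "'h::complex_hilbert \<Rightarrow>\<^sub>L 'h"
  assumes T: "form_between c C T" and Tl: "T - m *\<^sub>R id_blinfun \<in> HSh"
    and f: "continuous_on {c..C} f" and d: "(f has_real_derivative D) (at m)"
  shows "fun_calc f T - f m *\<^sub>R id_blinfun \<in> HSh"
proof -
  have TlHS: "T - m *\<^sub>R id_blinfun \<in> HS" using Tl by (simp add: HSh_def)
  define g where "g = (\<lambda>x. if x = m then D else (f x - f m) / (x - m))"
  have "continuous (at x within {c..C}) g" if x: "x \<in> {c..C}" for x
  proof (cases "x = m")
    case True
    have "((\<lambda>x. (f x - f m) / (x - m)) \<longlongrightarrow> D) (at m)"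
      using d by (simp add: has_field_derivative_iff)
    then have "(g \<longlongrightarrow> D) (at m)"
      by (rule Lim_transform_within[where d=1]) (auto simp: g_def)
    then have "(g \<longlongrightarrow> D) (at m within {c..C})"
      by (rule Lim_at_imp_Lim_at_within)
    moreover have "g m = D" by (simp add: g_def)
    ultimately have "(g \<longlongrightarrow> g m) (at m within {c..C})" by simp
    then show ?thesis by (simp add: continuous_within True)
  next
    case False
    have "((\<lambda>x. (f x - f m) / (x - m)) \<longlongrightarrow> (f x - f m) / (x - m)) (at x within {c..C})"
      using f x False by (intro tendsto_intros) (auto simp: continuous_on_def)
    then have "(g \<longlongrightarrow> (f x - f m) / (x - m)) (at x within {c..C})"
      by (rule Lim_transform_within[where d="dist x m"]) (use False in \<open>auto simp: g_def dist_commute\<close>)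
    then show ?thesis using False by (simp add: continuous_within g_def)
  qed
  then have g: "continuous_on {c..C} g" by (simp add: continuous_on_eq_continuous_within)
  define k where "k = (\<lambda>x. g x * (x - m))"
  have k: "continuous_on {c..C} k" unfolding k_def by (intro continuous_intros g)
  have fk: "f x = k x + f m" for x by (simp add: k_def g_def)
  have lin: "fun_calc (\<lambda>x. x - m) T = T - m *\<^sub>R id_blinfun"
    using fun_calc_poly[OF T, of "\<lambda>x. x - m" "[:- m, 1:]"] by (simp add: poly_op_linear)
  have "continuous_on {c..C} (\<lambda>x. x - m)" by (intro continuous_intros)
  then have "fun_calc k T = fun_calc g T o\<^sub>L fun_calc (\<lambda>x. x - m) T"
    by (rule fun_calc_mult[OF T g]) (simp add: k_def)
  moreover have "fun_calc f T = fun_calc k T + f m *\<^sub>R id_blinfun"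
    by (rule fun_calc_add_const[OF T k fk])
  ultimately have eq: "fun_calc f T - f m *\<^sub>R id_blinfun = (fun_calc g T o\<^sub>L (T - m *\<^sub>R id_blinfun))"
    by (simp only: lin add_diff_cancel_right')
  have "complex_linear (fun_calc g T)"
    by (intro selfadjoint_complex_linear selfadjoint_fun_calc[OF T g])
  then have "fun_calc f T - f m *\<^sub>R id_blinfun \<in> HS"
    unfolding eq by (rule HS_compose_left) (rule TlHS)
  moreover have "selfadjoint (fun_calc f T - f m *\<^sub>R id_blinfun)"
    by (intro selfadjoint_diff selfadjoint_scaleR selfadjoint_id selfadjoint_fun_calc[OF T f])
  ultimately show ?thesis unfolding HSh_def mem_Collect_eq by (rule conjI)
qed


section \<open>Real powers of positive invertible operators\<close>

lemma form_between_positive_invertible: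
  fixes T :: "'h::complex_hilbert \<Rightarrow>\<^sub>L 'h"
  assumes "selfadjoint T" "\<And>x. 0 \<le> inner (T x) x" "invertible_op T"
  obtains c C where "c > 0" "form_between c C T"
proof -
  obtain c where c: "c > 0" "\<And>x. c * (norm x)\<^sup>2 \<le> inner (T x) x"
    using positive_invertible_coercive[OF assms] by blast
  have "inner (T x) x \<le> norm T * (norm x)\<^sup>2" for x
  proof -
    have "inner (T x) x \<le> norm (T x) * norm x" by (rule norm_cauchy_schwarz)
    also have "\<dots> \<le> norm T * norm x * norm x" by (intro mult_right_mono norm_blinfun) simp
    finally show ?thesis by (simp add: power2_eq_square mult.assoc)
  qed
  then have "form_between c (norm T) T"
    using assms(1) c by (simp add: form_between_def)
  with c(1) show ?thesis by (rule that)
qed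

text \<open>The lower bound \<open>c > 0\<close> keeps the interval away from \<open>0\<close>, so that all real powers, negative ones
  included, are continuous on it, and the laws of exponents carry over from numbers to operators.\<close>

context
  fixes T :: "'h::complex_hilbert \<Rightarrow>\<^sub>L 'h" and c C :: real
  assumes T: "form_between c C T" and c: "c > 0"
begin

lemma continuous_on_powr_between: "continuous_on {c..C} (\<lambda>x. x powr t)"
  by (intro continuous_on_powr' continuous_on_id continuous_on_const) (use c in auto)

lemma selfadjoint_op_powr: "selfadjoint (op_powr T t)"
  unfolding op_powr_def by (rule selfadjoint_fun_calc[OF T continuous_on_powr_between])

lemma op_powr_add: "op_powr T (s + t) = op_powr T s o\<^sub>L op_powr T t"
  unfolding op_powr_def
  by (rule fun_calc_mult[OF T continuous_on_powr_between continuous_on_powr_between]) (simp add: powr_add)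

lemma op_powr_0: "op_powr T 0 = id_blinfun"
proof -
  have "x powr 0 = poly [:1:] x" if "x \<in> {c..C}" for x
    using c that by simp
  from fun_calc_poly[OF T this] show ?thesis
    unfolding op_powr_def poly_op_const by simp
qed

lemma op_powr_minus: "op_powr T t o\<^sub>L op_powr T (- t) = id_blinfun"
  unfolding op_powr_add[symmetric] by (simp only: add.right_inverse op_powr_0)

lemma invertible_op_powr: "invertible_op (op_powr T t)"
  unfolding invertible_op_def using op_powr_minus[of t] op_powr_minus[of "- t"]
  by (intro exI[of _ "op_powr T (- t)"] conjI) (simp_all only: minus_minus)

lemma op_powr_HSh:
  assumes "T - m *\<^sub>R id_blinfun \<in> HSh" "m > 0"
  shows "op_powr T t - (m powr t) *\<^sub>R id_blinfun \<in> HSh"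
  unfolding op_powr_def
  by (rule fun_calc_HSh[OF T assms(1) continuous_on_powr_between has_real_derivative_powr[OF assms(2)]])

end


section \<open>Geodesics between points of a leaf\<close>

lemma selfadjoint_op_of: "selfadjoint (op_of p)"
proof (rule selfadjoint_HSh_shift)
  show "op_of p - sc_part p *\<^sub>R id_blinfun \<in> HSh"
    by (simp add: op_of_parts[of p])
qed

lemma positive_op_iff:
  fixes T :: "'h::complex_hilbert \<Rightarrow>\<^sub>L 'h"
  assumes T: "selfadjoint T"
  shows "positive_op T \<longleftrightarrow> (\<forall>x. 0 \<le> inner (T x) x)"
proof -
  have "Im (cinner (T x) x) = 0" for x
  proof -
    have "cinner (T x) x = cnj (cinner (T x) x)"
      using T cinner_commute[of "T x" x] by (simp add: selfadjoint_def)
    then show ?thesis by (metis Reals_cnj_iff complex_is_Real_iff)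
  qed
  then show ?thesis
    using selfadjoint_complex_linear[OF T]
    by (simp add: positive_op_def complex_nonneg_Reals_iff Re_cinner)
qed

lemma Sigma_pos_iff:
  "p \<in> Sigma_pos \<longleftrightarrow> (\<forall>x. 0 \<le> inner (op_of p x) x) \<and> invertible_op (op_of p)"
  by (simp add: Sigma_pos_def positive_op_iff[OF selfadjoint_op_of])

lemma leaf_iff: "p \<in> leaf l \<longleftrightarrow> p \<in> Sigma_pos \<and> sc_part p = l"
  unfolding leaf_def using parts_eq(2) op_of_parts hs_part_HSh by blast

text \<open>Scalar parts multiply and pass through powers: with \<open>p\<close> and \<open>q\<close> of scalar part \<open>l\<close>, the operator
  \<open>X = p\<^sup>-\<^sup>1\<^sup>/\<^sup>2 q p\<^sup>-\<^sup>1\<^sup>/\<^sup>2\<close> has scalar part \<open>1\<close>, hence so has \<open>X\<^sup>t\<close>, and \<open>p\<^sup>1\<^sup>/\<^sup>2 X\<^sup>t p\<^sup>1\<^sup>/\<^sup>2\<close> has scalar part \<open>l\<close>.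
  Positivity and invertibility come from writing the latter as \<open>Z\<^sup>* Z\<close> with \<open>Z = X\<^sup>t\<^sup>/\<^sup>2 p\<^sup>1\<^sup>/\<^sup>2\<close> invertible. The
  argument is valid for all real \<open>t\<close>: a leaf contains the complete geodesics through its points.\<close>

lemma geodesic_in_leaf:
  assumes l: "l > 0" and p: "p \<in> leaf l" and q: "q \<in> leaf l"
  shows "geodesic p q t \<in> op_of ` leaf l"
proof -
  define A where "A = op_of p"
  define B where "B = op_of q"
  have AB: "A - l *\<^sub>R id_blinfun \<in> HSh" "B - l *\<^sub>R id_blinfun \<in> HSh"
    using p q by (auto simp: A_def B_def leaf_def)
  have saB: "selfadjoint B" by (simp add: B_def selfadjoint_op_of)
  have posA: "0 \<le> inner (A x) x" and posB: "0 \<le> inner (B x) x" for x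
    using p q by (simp_all add: A_def B_def leaf_iff Sigma_pos_iff)
  have invA: "invertible_op A" and invB: "invertible_op B"
    using p q by (simp_all add: A_def B_def leaf_iff Sigma_pos_iff)
  have "selfadjoint A" by (simp add: A_def selfadjoint_op_of)
  then obtain c C where A: "form_between c C A" and c: "c > 0"
    using posA invA by (rule form_between_positive_invertible)
  define R where "R = op_powr A (1/2)"
  define V where "V = op_powr A (-1/2)"
  have sa: "selfadjoint R" "selfadjoint V"
    unfolding R_def V_def by (rule selfadjoint_op_powr[OF A c])+
  have inv: "invertible_op R" "invertible_op V"
    unfolding R_def V_def by (rule invertible_op_powr[OF A c])+
  have RV: "R - (l powr (1/2)) *\<^sub>R id_blinfun \<in> HSh" "V - (l powr (-1/2)) *\<^sub>R id_blinfun \<in> HSh"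
    unfolding R_def V_def by (rule op_powr_HSh[OF A c AB(1) l])+
  define X where "X = V o\<^sub>L B o\<^sub>L V"
  have "l powr (-1/2) * l * l powr (-1/2) = l powr (-1/2) * l powr 1 * l powr (-1/2)"
    using l by simp
  also have "\<dots> = 1" using l by (simp only: powr_add[symmetric]) simp
  finally have "X - 1 *\<^sub>R id_blinfun \<in> HSh"
    using HSh_sandwich[OF RV(2) AB(2)] by (simp add: X_def)
  note X1 = this
  have "selfadjoint X" unfolding X_def by (intro selfadjoint_sandwich sa saB)
  moreover have "0 \<le> inner (X x) x" for x
    using posB[of "V x"] by (simp add: X_def selfadjoint_inner[OF sa(2)])
  moreover have "invertible_op X"
    unfolding X_def by (intro invertible_op_compose inv invB)
  ultimately obtain d D where X: "form_between d D X" and d: "d > 0"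
    by (rule form_between_positive_invertible)
  define Y where "Y = op_powr X (t/2)"
  have Y: "selfadjoint Y" "invertible_op Y"
    unfolding Y_def by (rule selfadjoint_op_powr[OF X d], rule invertible_op_powr[OF X d])
  have YY: "op_powr X t = Y o\<^sub>L Y"
    unfolding Y_def using op_powr_add[OF X d, of "t/2" "t/2"] by simp
  define G where "G = R o\<^sub>L op_powr X t o\<^sub>L R"
  have geo: "geodesic p q t = G"
    by (simp add: geodesic_def G_def X_def R_def V_def A_def B_def)
  have "op_powr X t - 1 *\<^sub>R id_blinfun \<in> HSh"
    using op_powr_HSh[OF X d X1] by simp
  from HSh_sandwich[OF RV(1) this]
  have "G - (l powr (1/2) * 1 * l powr (1/2)) *\<^sub>R id_blinfun \<in> HSh"
    by (simp add: G_def)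
  moreover have "l powr (1/2) * 1 * l powr (1/2) = l"
    using l by (simp add: powr_add[symmetric])
  ultimately have Gl: "G - l *\<^sub>R id_blinfun \<in> HSh" by simp
  define r where "r = HR_of G"
  have r: "op_of r = G"
    unfolding r_def by (rule op_of_HR_of[OF Gl, where l=l]) simp
  have "inner (G x) x = (norm (Y (R x)))\<^sup>2" for x
    by (simp add: G_def YY selfadjoint_inner[OF sa(1)] selfadjoint_inner[OF Y(1)] power2_norm_eq_inner)
  moreover have "invertible_op G"
    unfolding G_def YY by (intro invertible_op_compose inv Y)
  ultimately have "r \<in> Sigma_pos" by (simp add: Sigma_pos_iff r)
  moreover have "sc_part r = l"
    by (rule parts_eq(2)[OF Gl]) (simp add: r)
  ultimately have "r \<in> leaf l" by (simp add: leaf_iff)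
  then show ?thesis using geo r by (metis imageI)
qed


section \<open>Openness of the cone and translation charts\<close>

lemma norm_op_of_le: "norm (op_of p) \<le> 2 * norm p"
proof -
  have "norm (op_of p) \<le> norm (hs_part p) + \<bar>sc_part p\<bar> * norm (id_blinfun :: 'a \<Rightarrow>\<^sub>L 'a)"
    unfolding op_of_parts[of p] by (rule order_trans[OF norm_triangle_ineq]) simp
  also have "\<dots> \<le> norm (hs_part p) + \<bar>sc_part p\<bar> * 1"
    by (intro add_left_mono mult_left_mono norm_blinfun_id_le) simp
  also have "\<dots> \<le> 2 * norm p"
    using hs_part_le[of p] sc_part_le[of p] by simp
  finally show ?thesis .
qed

text \<open>A positive invertible \<open>p\<close> is coercive with some constant \<open>m\<close>, and the operator norm is at most twice the
  norm of \<open>\<H>\<^sub>\<real>\<close>; so a perturbation of norm below \<open>m / 4\<close> costs at most half of the coercivity constant.\<close>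

lemma open_Sigma_pos: "open (Sigma_pos :: 'h::inf_sep_complex_hilbert HR set)"
  unfolding open_dist
proof
  fix p :: "'h HR" assume "p \<in> Sigma_pos"
  then have "\<And>x. 0 \<le> inner (op_of p x) x" "invertible_op (op_of p)"
    by (simp_all add: Sigma_pos_iff)
  then obtain m where m: "m > 0" "\<And>x. m * (norm x)\<^sup>2 \<le> inner (op_of p x) x"
    using positive_invertible_coercive[OF selfadjoint_op_of] by blast
  have "q \<in> Sigma_pos" if q: "dist q p < m / 4" for q
  proof -
    have co: "m / 2 * (norm x)\<^sup>2 \<le> inner (op_of q x) x" for x
    proof -
      have "norm (op_of (q - p)) \<le> m / 2"
        using norm_op_of_le[of "q - p"] q by (simp add: dist_norm)
      then have "norm (op_of (q - p)) * norm x \<le> m / 2 * norm x"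
        by (rule mult_right_mono) simp
      with norm_blinfun have "norm (op_of (q - p) x) \<le> m / 2 * norm x"
        by (rule order_trans)
      then have "norm (op_of (q - p) x) * norm x \<le> m / 2 * norm x * norm x"
        by (rule mult_right_mono) simp
      moreover have "\<bar>inner (op_of (q - p) x) x\<bar> \<le> norm (op_of (q - p) x) * norm x"
        by (rule Cauchy_Schwarz_ineq2)
      moreover have "inner (op_of q x) x = inner (op_of p x) x + inner (op_of (q - p) x) x"
        by (simp add: blinfun.diff_left inner_diff_left)
      ultimately show ?thesis
        using m(2)[of x] unfolding power2_eq_square mult.assoc[symmetric] by linarith
    qed
    have "0 \<le> inner (op_of q x) x" for x
      using m(1) by (intro order_trans[OF _ co]) simp
    moreover have "invertible_op (op_of q)"
      using m(1) co by (intro coercive_invertible[of "m / 2"]) simp_all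
    ultimately show ?thesis by (simp add: Sigma_pos_iff)
  qed
  then show "\<exists>e>0. \<forall>q. dist q p < e \<longrightarrow> q \<in> Sigma_pos"
    using m(1) by (intro exI[of _ "m / 4"]) simp
qed

text \<open>The first derivative is the identity and all higher ones vanish. Only the values on \<open>U\<close> are prescribed,
  so that the lemma also covers \<open>the_inv_into\<close> of a translation.\<close>

lemma smooth_on_translation:
  fixes a :: "'a::real_normed_vector"
  assumes U: "open U" and f: "\<And>x. x \<in> U \<Longrightarrow> f x = a + x"
  shows "smooth_on U f"
proof -
  define D :: "nat \<Rightarrow> 'a \<Rightarrow> 'a list \<Rightarrow> 'a" where
    "D = (\<lambda>k x vs. if k = 0 then a + x else if k = 1 then hd vs else 0)"
  have "bounded_multilinear k (D k x)" for k x
  proof -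
    consider "k = 0" | "k = 1" | "k \<ge> 2" by linarith
    then show ?thesis
    proof cases
      case 1
      then show ?thesis by (simp add: bounded_multilinear_def D_def) (rule exI[of _ "norm (a + x)"], simp)
    next
      case 2
      have "linear (\<lambda>v::'a. v)" by (simp add: linear_iff)
      moreover have "norm (hd vs) \<le> 1 * prod_list (map norm vs)" if "length vs = 1" for vs :: "'a list"
        using that by (cases vs) simp_all
      ultimately show ?thesis
        using 2 unfolding bounded_multilinear_def D_def
        by (intro conjI allI impI exI[of _ 1]) simp_all
    next
      case 3
      have "linear (\<lambda>v::'a. 0 :: 'a)" by (simp add: linear_iff)
      then show ?thesis
        using 3 unfolding bounded_multilinear_def D_def
        by (intro conjI allI impI exI[of _ 0]) simp_all
    qed
  qed
  moreover have "D k y vs - D k x vs - D (Suc k) x ((y - x) # vs) = 0" for k x y vs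
    by (simp add: D_def)
  moreover have "D 0 x [] = f x" if "x \<in> U" for x
    using f[OF that] by (simp add: D_def)
  moreover have "0 \<le> prod_list (map norm vs)" for vs :: "'a list"
    by (induction vs) simp_all
  ultimately show ?thesis
    unfolding smooth_on_def using U
    by (intro conjI exI[of _ D] ballI allI impI exI[of _ 1]) simp_all
qed

lemma diffeo_on_translation:
  fixes a :: "'a::real_normed_vector"
  assumes U: "open U"
  shows "diffeo_on U ((+) a)"
  unfolding diffeo_on_def
proof (intro conjI)
  show inj: "inj_on ((+) a) U" by simp
  show "smooth_on U ((+) a)" using U by (rule smooth_on_translation) simp
  show "smooth_on ((+) a ` U) (the_inv_into U ((+) a))"
  proof (rule smooth_on_translation)
    show "open ((+) a ` U)" using U by (rule open_translation)
    show "the_inv_into U ((+) a) y = - a + y" if "y \<in> (+) a ` U" for y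
      using that the_inv_into_f_f[OF inj] by auto
  qed
qed

lemma bounded_linear_sc_part: "bounded_linear sc_part"
  by (rule bounded_linear_intro[where K=1]) (simp_all add: sc_part_add sc_part_scaleR sc_part_le)

text \<open>A single slice chart suffices: the translation by \<open>- a\<close>, defined on all of \<open>\<Omega>\<close>.\<close>

lemma closed_submanifold_of_translate:
  fixes F :: "'a::{real_inner, complete_space} set"
  assumes \<Omega>: "open \<Omega>" and F: "subspace F" "closed F"
  shows "closed_submanifold_of (\<Omega> \<inter> (+) a ` F) \<Omega>"
  unfolding closed_submanifold_of_def submanifold_of_def
proof (intro conjI ballI)
  fix p
  assume p: "p \<in> \<Omega> \<inter> (+) a ` F"
  have "(+) (- a) ` (\<Omega> \<inter> (\<Omega> \<inter> (+) a ` F)) = (+) (- a) ` \<Omega> \<inter> F"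
  proof -
    have "\<Omega> \<inter> (\<Omega> \<inter> (+) a ` F) = \<Omega> \<inter> (+) a ` F" by blast
    then show ?thesis by (simp add: image_Int image_image)
  qed
  then show "\<exists>U \<phi> G. p \<in> U \<and> U \<subseteq> \<Omega> \<and> diffeo_on U (\<phi> :: 'a \<Rightarrow> 'a) \<and> subspace G \<and> closed G \<and>
      \<phi> ` (U \<inter> (\<Omega> \<inter> (+) a ` F)) = \<phi> ` U \<inter> G"
    using p \<Omega> F by (intro exI[of _ \<Omega>] exI[of _ "(+) (- a)"] exI[of _ F] conjI diffeo_on_translation) auto
next
  have "closed ((+) a ` F)" using F(2) by (rule closed_translation)
  then show "closedin (top_of_set \<Omega>) (\<Omega> \<inter> (+) a ` F)" by (rule closedin_closed_Int)
qed (use \<Omega> in auto)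

theorem proposition7p1:
  fixes l :: real
  assumes "l > 0"
  shows "geodesically_convex (leaf l :: 'h::inf_sep_complex_hilbert HR set) \<and>
         closed_submanifold_of (leaf l :: 'h HR set) Sigma_pos"
proof
  show "geodesically_convex (leaf l :: 'h HR set)"
    unfolding geodesically_convex_def
  proof (intro conjI ballI image_subsetI)
    show "leaf l \<subseteq> (Sigma_pos :: 'h HR set)" by (simp add: leaf_iff subset_iff)
  qed (rule geodesic_in_leaf[OF assms])
  \<comment> \<open>the leaf is the part of the affine hyperplane \<open>l + HS\<^sup>h\<close> that lies in the open cone\<close>
  define F where "F = {p :: 'h HR. sc_part p = 0}"
  interpret sc: bounded_linear "sc_part :: 'h HR \<Rightarrow> real"
    by (rule bounded_linear_sc_part)
  have F: "subspace F" "closed F"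
    unfolding F_def subspace_def
    by (auto simp: sc.zero sc.add sc.scaleR intro!: closed_Collect_eq sc.continuous_on continuous_on_id)
  define u :: "'h HR" where "u = HR_of (l *\<^sub>R id_blinfun)"
  have "op_of u = 0 + l *\<^sub>R id_blinfun"
    unfolding u_def by (subst op_of_HR_of[OF HSh_zero, where l=l]) simp_all
  then have u: "sc_part u = l" by (rule parts_eq(2)[OF HSh_zero])
  have "p \<in> (+) u ` F \<longleftrightarrow> sc_part p = l" for p :: "'h HR"
  proof -
    have "p \<in> (+) u ` F \<longleftrightarrow> p - u \<in> F"
      using image_eqI[of p "(+) u" "p - u" F] by auto
    then show ?thesis by (simp add: F_def sc.diff u)
  qed
  then have "leaf l = Sigma_pos \<inter> (+) u ` F"
    by (intro set_eqI) (simp only: leaf_iff Int_iff)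
  then show "closed_submanifold_of (leaf l :: 'h HR set) Sigma_pos"
    using closed_submanifold_of_translate[OF open_Sigma_pos F] by simp
qed

end
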